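(* Let $\mu$ be a compactly supported probability measure on $\mathbb{R}$ with infinitely many points in its support and Jacobi parameters $\{a_n,b_n\}_{n=1}^\infty$, and let $x_0\in\mathbb{R}$ be a strong Lebesgue point of $\mu$. Let $K_n$ be the $n$th Christoffel-Darboux kernel of $\mu$. Assume that, for some positive number $\rho(x_0)$, $$\lim_{n\to\infty}\frac{K_n\left(x_0+\frac{a}{n},x_0+\frac{b}{n}\right)}{n}=\frac{\sin\left(\pi\rho(x_0)(b-a)\right)}{\pi w(x_0)(b-a)}$$ uniformly for $a,b$ in compact subsets of $\mathbb{C}$. For $\beta_1\in\mathbb{R}$ let $\mu^{(\beta_1)}$ be the probability measure whose Jacobi parameters are $\{a_n,b_n+\beta_1\delta_{n1}\}_{n=1}^\infty$, and let $K_n^{(\beta_1)}$ be its $n$th Christoffel-Darboux kernel. Then for any $\beta_1\in\mathbb{R}$, $$\lim_{n\to\infty}\frac{K_n^{(\beta_1)}\left(x_0+\frac{a}{n},x_0+\frac{b}{n}\right)}{n}=\frac{\sin\left(\pi\rho(x_0)(b-a)\right)}{\pi w^{(\beta_1)}(x_0)(b-a)}$$ uniformly for $a,b$ in compact subsets of $\mathbb{C}$, where $w^{(\beta_1)}(x_0)\neq0$ is the weight of $\mu^{(\beta_1)}$ at $x_0$.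
   Context: Write $d\mu(x)=w(x)\,dx+d\mu_{\mathrm{sing}}(x)$, where $\mu_{\mathrm{sing}}$ is the part of $\mu$ singular with respect to Lebesgue measure. Let $\{p_n\}_{n=0}^\infty$ be the orthonormal polynomials of $\mu$ (positive leading coefficients, $p_0\equiv 1$). The Jacobi parameters $\{a_n,b_n\}_{n=1}^\infty$ ($a_n>0$, $b_n\in\mathbb{R}$, bounded) are defined by $xp_n(x)=a_{n+1}p_{n+1}(x)+b_{n+1}p_n(x)+a_np_{n-1}(x)$ for $n\ge 1$ and $xp_0(x)=a_1p_1(x)+b_1p_0(x)$. The assignment $\mu\mapsto\{a_n,b_n\}$ is a bijection between compactly supported probability measures with infinite support and bounded real sequences with all $a_n>0$. The $n$th Christoffel-Darboux kernel of a measure with orthonormal polynomials $p_j$ is $K_n(x,y)=\sum_{j=0}^{n-1}p_j(x)p_j(y)$, $x,y\in\mathbb{C}$. With $F_\mu(z)=\int\frac{d\mu(t)}{t-z}$, a point $x_0$ is a strong Lebesgue point for $\mu$ if: (i) $F_\mu(x_0+i0)=\lim_{\varepsilon\to0+}F_\mu(x_0+i\varepsilon)$ exists and is finite; (ii) $\lim_{\varepsilon\to0+}\frac{\mu(x_0-\varepsilon,x_0+\varepsilon)}{2\varepsilon}=w(x_0)>0$, and $\lim_{\varepsilon\to0+}\frac{1}{2\varepsilon}\int_{x_0-\varepsilon}^{x_0+\varepsilon}|w(t)-w(x_0)|\,dt=0$. The weight $w^{(\beta_1)}$ is the Radon-Nikodym derivative of the absolutely continuous part of $\mu^{(\beta_1)}$,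 with its value at a strong Lebesgue point $x_0$ of $\mu$ taken to be $w^{(\beta_1)}(x_0)=\frac1\pi\lim_{\varepsilon\to0+}\operatorname{Im}\int\frac{d\mu^{(\beta_1)}(t)}{t-x_0-i\varepsilon}=\frac{w(x_0)}{1+2\beta_1\operatorname{Re}F_\mu(x_0+i0)+\beta_1^2|F_\mu(x_0+i0)|^2}$. Quotients of the form $\frac{\sin(c(b-a))}{b-a}$ are interpreted at $a=b$ by continuity, i.e. as $c$. *)

theory Defs
  imports "HOL-Probability.Probability" "HOL-Computational_Algebra.Polynomial"
begin

definition measure_support :: "real measure \<Rightarrow> real set" where
  "measure_support M = {x. \<forall>U. open U \<longrightarrow> x \<in> U \<longrightarrow> emeasure M U > 0}"

definition compact_nontrivial_prob :: "real measure \<Rightarrow> bool" where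
  "compact_nontrivial_prob M \<longleftrightarrow>
     prob_space M \<and> sets M = sets borel \<and>
     compact (measure_support M) \<and> infinite (measure_support M)"

definition lebesgue_singular :: "real measure \<Rightarrow> bool" where
  "lebesgue_singular S \<longleftrightarrow>
     sets S = sets borel \<and>
     (\<exists>N \<in> sets borel. emeasure lborel N = 0 \<and> emeasure S (- N) = 0)"

text \<open>The weight is determined by the measure only up to Lebesgue null sets, so being a
  weight is a relation: \<open>w\<close> is some version of the density of the absolutely continuous part
  in the Lebesgue decomposition of \<open>M\<close>.\<close>

definition is_weight :: "real measure \<Rightarrow> (real \<Rightarrow> real) \<Rightarrow> bool" where
  "is_weight M w \<longleftrightarrow>
     w \<in> borel_measurable borel \<and> (\<forall>x. 0 \<le> w x) \<and>
     (\<exists>S. lebesgue_singular S \<and>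
        (\<forall>A \<in> sets borel.
           emeasure M A = emeasure (density lborel (\<lambda>x. ennreal (w x))) A + emeasure S A))"

definition orthonormal_polys :: "real measure \<Rightarrow> (nat \<Rightarrow> real poly) \<Rightarrow> bool" where
  "orthonormal_polys M p \<longleftrightarrow>
     (\<forall>n. degree (p n) = n \<and> lead_coeff (p n) > 0) \<and>
     (\<forall>m n. (\<integral>x. poly (p m) x * poly (p n) x \<partial>M) = (if m = n then 1 else 0))"

text \<open>The sequences are indexed from 1; the values \<open>a 0\<close> and \<open>b 0\<close> play no role.\<close>

definition jacobi_parameters ::
    "real measure \<Rightarrow> (nat \<Rightarrow> real) \<Rightarrow> (nat \<Rightarrow> real) \<Rightarrow> bool" where
  "jacobi_parameters M a b \<longleftrightarrow>
     (\<forall>n\<ge>1. a n > 0) \<and> bounded (a ` {1..}) \<and> bounded (b ` {1..}) \<and>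
     (\<exists>p. orthonormal_polys M p \<and>
        [:0, 1:] * p 0 = smult (a 1) (p 1) + smult (b 1) (p 0) \<and>
        (\<forall>n\<ge>1. [:0, 1:] * p n =
           smult (a (n + 1)) (p (n + 1)) + smult (b (n + 1)) (p n) + smult (a n) (p (n - 1))))"

text \<open>The kernel is bilinear, without complex conjugation in the second argument.\<close>

definition cd_kernel :: "(nat \<Rightarrow> real poly) \<Rightarrow> nat \<Rightarrow> complex \<Rightarrow> complex \<Rightarrow> complex" where
  "cd_kernel p n x y =
     (\<Sum>j<n. poly (map_poly complex_of_real (p j)) x * poly (map_poly complex_of_real (p j)) y)"

definition stieltjes :: "real measure \<Rightarrow> complex \<Rightarrow> complex" where
  "stieltjes M z = (\<integral>t. 1 / (complex_of_real t - z) \<partial>M)"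

text \<open>The boundary value \<open>F(x + i0)\<close>; meaningful only where the limit exists.\<close>

definition stieltjes_bdry :: "real measure \<Rightarrow> real \<Rightarrow> complex" where
  "stieltjes_bdry M x = Lim (at_right 0) (\<lambda>\<epsilon>. stieltjes M (Complex x \<epsilon>))"

definition strong_lebesgue_point :: "real measure \<Rightarrow> (real \<Rightarrow> real) \<Rightarrow> real \<Rightarrow> bool" where
  "strong_lebesgue_point M w x0 \<longleftrightarrow>
     (\<exists>L. ((\<lambda>\<epsilon>. stieltjes M (Complex x0 \<epsilon>)) \<longlongrightarrow> L) (at_right 0)) \<and>
     ((\<lambda>\<epsilon>. measure M {x0 - \<epsilon> <..< x0 + \<epsilon>} / (2 * \<epsilon>)) \<longlongrightarrow> w x0) (at_right 0) \<and>
     w x0 > 0 \<and>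
     ((\<lambda>\<epsilon>. (1 / (2 * \<epsilon>)) * (LBINT t:{x0 - \<epsilon> .. x0 + \<epsilon>}. \<bar>w t - w x0\<bar>)) \<longlongrightarrow> 0) (at_right 0)"

text \<open>\<open>sin (c * z) / z\<close>, extended by continuity to \<open>z = 0\<close>.\<close>

definition sin_quotient :: "complex \<Rightarrow> complex \<Rightarrow> complex" where
  "sin_quotient c z = (if z = 0 then c else sin (c * z) / z)"

text \<open>Bulk universality at \<open>x0\<close> for the kernels built from \<open>p\<close>, with density \<open>\<rho>\<close> and weight
  value \<open>w0\<close>, uniformly on compact sets. The term \<open>n = 0\<close> is a dummy.\<close>

definition sine_kernel_asymptotics ::
    "(nat \<Rightarrow> real poly) \<Rightarrow> real \<Rightarrow> real \<Rightarrow> real \<Rightarrow> bool" where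
  "sine_kernel_asymptotics p x0 \<rho> w0 \<longleftrightarrow>
     (\<forall>A B. compact A \<longrightarrow> compact B \<longrightarrow>
        uniform_limit (A \<times> B)
          (\<lambda>n (a, b). cd_kernel p n (of_real x0 + a / of_nat n) (of_real x0 + b / of_nat n)
                        / of_nat n)
          (\<lambda>(a, b). sin_quotient (of_real (pi * \<rho>)) (b - a) / of_real (pi * w0))
          sequentially)"

end

theory Submission
  imports Defs "HOL-Complex_Analysis.Complex_Analysis"
begin

text \<open>
  Let \<open>q\<close> be the second solution of the Jacobi recursion of \<open>\<mu>\<close>, with \<open>q\<^sub>0 = 0\<close> and \<open>q\<^sub>1 = 1 / a\<^sub>1\<close>.
  Adding \<open>\<beta>\<close> to \<open>b\<^sub>1\<close> only affects the first line of the recursion, so the perturbed polynomials are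
  \<open>p - \<beta> q\<close> (\<open>perturbed_polynomials\<close>). With \<open>W(u, v) = a\<^sub>n (u\<^sub>n v\<^sub>n\<^sub>-\<^sub>1 - u\<^sub>n\<^sub>-\<^sub>1 v\<^sub>n)\<close> the
  Christoffel-Darboux formula reads \<open>W(p(x), p(y)) = (x - y) K\<^sub>n(x, y)\<close>, and likewise for the
  perturbed polynomials. Values of solutions at \<open>n\<close> and \<open>n - 1\<close> are vectors in a plane, so the
  Pluecker relation expresses the perturbed kernel through Wronskians of \<open>p - \<beta> q\<close> with \<open>p\<close>. It thus
  suffices to find the scaling limit of the mixed Wronskian \<open>Q\<^sub>n(x, y) = W(q(x), p(y))\<close>, taken
  at the points \<open>x0 + x / n\<close> and \<open>x0 + y / n\<close>.

  Here the boundary value \<open>L = F(x0 + i0)\<close> of the Stieltjes transform enters. The Weyl solution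
  \<open>q + F p\<close> consists of the Fourier coefficients of \<open>1 / (t - z)\<close>, whence
  \<open>\<Sum> \<bar>q\<^sub>j + F p\<^sub>j\<bar>\<^sup>2 \<le> Im F / Im z\<close>. Together with the assumed asymptotics of \<open>S\<^sub>n = W(p(x), p(y))\<close>
  this bounds \<open>Q\<^sub>n + F\<^sub>n S\<^sub>n\<close> by \<open>1 + C \<bar>x - y\<bar> / sqrt (Im x)\<close> for real \<open>y\<close> and \<open>x\<close> in the upper half plane
  (\<open>Q_Weyl_bound\<close>), where the rescaled transforms \<open>F\<^sub>n\<close> tend to \<open>L\<close> (\<open>F_tendsto\<close>). The functions
  \<open>Q\<^sub>n(\<cdot>, y)\<close> are therefore a normal family of entire functions. A limit of them differs from an
  explicit combination of \<open>sin \<theta>\<close> and \<open>cos \<theta>\<close>, \<open>\<theta> = \<pi> \<rho> (x - y)\<close>, by an entire function of growth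
  \<open>O(1 + \<bar>x\<bar> / sqrt \<bar>Im x\<bar>)\<close>, which is constant by a version of Liouville's theorem
  (\<open>liouville_off_real_axis\<close>). The Pluecker relation rules out a nonzero constant, and this
  also yields \<open>Im L = \<pi> w(x0)\<close> (\<open>Im_boundary_value\<close>). Inserting the limit of \<open>Q\<^sub>n\<close> into the formula for
  the perturbed kernel produces the sine kernel with \<open>w(x0)\<close> replaced by
  \<open>w(x0) / \<bar>1 + \<beta> L\<bar>\<^sup>2\<close> (\<open>perturbed_kernel_scaling\<close>).

  That this number is the boundary value of the perturbed weight follows from
  \<open>F\<^sub>\<beta> (1 + \<beta> F) = F\<close> (\<open>stieltjes_perturbation\<close>): the Wronskian of the Weyl solutions of both measures
  is constant in \<open>n\<close> and tends to \<open>0\<close>.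
\<close>

section \<open>Orthonormal polynomials\<close>

text \<open>
  Subtracting the right multiple of the member of the same degree lowers the degree, so
  every polynomial is reached from \<open>0\<close> by steps \<open>r \<mapsto> c p\<^sub>n + r\<close> with \<open>r\<close> of degree below \<open>n\<close>.
\<close>

lemma graded_poly_induct [consumes 1, case_names zero step]:
  fixes p :: "nat \<Rightarrow> real poly"
  assumes deg: "\<forall>n. degree (p n) = n \<and> lead_coeff (p n) > 0"
    and zero: "P 0"
    and step: "\<And>n c r. P r \<Longrightarrow> r = 0 \<or> degree r < n \<Longrightarrow> c \<noteq> 0 \<Longrightarrow>
                 degree (smult c (p n) + r) = n \<Longrightarrow> P (smult c (p n) + r)"
  shows "P f"
proof (induction "degree f" arbitrary: f rule: less_induct)
  case less
  show ?case
  proof (cases "f = 0")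
    case True
    then show ?thesis using zero by simp
  next
    case False
    define n where "n = degree f"
    define c where "c = lead_coeff f / lead_coeff (p n)"
    define r where "r = f - smult c (p n)"
    have pn: "degree (p n) = n" "lead_coeff (p n) > 0"
      using deg by blast+
    have c: "c \<noteq> 0"
      using False pn by (simp add: c_def)
    have "degree r \<le> n"
      unfolding r_def using pn c by (intro degree_diff_le) (auto simp: n_def)
    moreover have "coeff r n = 0"
      using pn by (simp add: r_def c_def n_def)
    ultimately have r: "r = 0 \<or> degree r < n"
      by (rule eq_zero_or_degree_less)
    have f: "f = smult c (p n) + r"
      by (simp add: r_def)
    have "P r"
      using r less.hyps[of r] zero by (auto simp: n_def)
    moreover have "degree (smult c (p n) + r) = n"
      using f by (simp add: n_def)
    ultimately show ?thesis
      using step[OF _ r c] f by simp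
  qed
qed

lemma orthonormal_degree:
  "orthonormal_polys M p \<Longrightarrow> \<forall>n. degree (p n) = n \<and> lead_coeff (p n) > 0"
  unfolding orthonormal_polys_def by blast

lemma orthonormal_integral:
  "orthonormal_polys M p \<Longrightarrow>
     (\<integral>x. poly (p m) x * poly (p n) x \<partial>M) = (if m = n then 1 else 0)"
  by (simp add: orthonormal_polys_def)

lemma poly_borel_measurable:
  fixes f :: "real poly"
  shows "sets M = sets borel \<Longrightarrow> poly f \<in> borel_measurable M"
  by (subst measurable_cong_sets[of M borel])
     (auto intro!: borel_measurable_continuous_onI continuous_intros)

lemma integrable_mult_of_squares:
  fixes f g :: "'a \<Rightarrow> real"
  assumes [measurable]: "f \<in> borel_measurable M" "g \<in> borel_measurable M"
    and "integrable M (\<lambda>x. f x * f x)" "integrable M (\<lambda>x. g x * g x)"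
  shows "integrable M (\<lambda>x. f x * g x)"
proof (rule Bochner_Integration.integrable_bound)
  show "integrable M (\<lambda>x. f x * f x + g x * g x)"
    using assms by simp
  have "\<bar>u * v\<bar> \<le> u * u + v * v" for u v :: real
  proof -
    have "0 \<le> (\<bar>u\<bar> - \<bar>v\<bar>)\<^sup>2" by simp
    then have "2 * (\<bar>u\<bar> * \<bar>v\<bar>) \<le> u * u + v * v"
      by (simp add: power2_eq_square algebra_simps)
    moreover have "0 \<le> \<bar>u\<bar> * \<bar>v\<bar>" by simp
    ultimately show ?thesis unfolding abs_mult by linarith
  qed
  then show "AE x in M. norm (f x * g x) \<le> norm (f x * f x + g x * g x)"
    by (auto intro!: AE_I2 order_trans[OF _ abs_ge_self])
qed simp

lemma integrable_square_add:
  fixes f g :: "'a \<Rightarrow> real"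
  assumes [measurable]: "f \<in> borel_measurable M" "g \<in> borel_measurable M"
    and "integrable M (\<lambda>x. f x * f x)" "integrable M (\<lambda>x. g x * g x)"
  shows "integrable M (\<lambda>x. (f x + g x) * (f x + g x))"
proof -
  have "integrable M (\<lambda>x. f x * f x + 2 * (f x * g x) + g x * g x)"
    using assms integrable_mult_of_squares[OF assms] by simp
  then show ?thesis
    by (simp add: algebra_simps)
qed

text \<open>
  A non-integrable function has Bochner integral \<open>0\<close>, so the normalisation
  \<open>\<integral> p\<^sub>n\<^sup>2 = 1\<close> already puts every \<open>p\<^sub>n\<close>, and with them every polynomial, into \<open>L\<^sup>2\<close>.
\<close>

lemma orthonormal_poly_square_integrable:
  assumes on: "orthonormal_polys M p" and M: "sets M = sets borel"
  shows "integrable M (\<lambda>x. poly f x * poly f x)"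
  using orthonormal_degree[OF on]
proof (induction f rule: graded_poly_induct)
  case zero
  then show ?case by simp
next
  case (step n c r)
  have "integrable M (\<lambda>x. poly (p n) x * poly (p n) x)"
    using orthonormal_integral[OF on, of n n] not_integrable_integral_eq by fastforce
  then have "integrable M (\<lambda>x. c * c * (poly (p n) x * poly (p n) x))"
    by simp
  then have "integrable M (\<lambda>x. (c * poly (p n) x) * (c * poly (p n) x))"
    by (simp add: mult_ac)
  then show ?case
    using step integrable_square_add[of "\<lambda>x. c * poly (p n) x" M "poly r"]
      poly_borel_measurable[OF M] by simp
qed

lemma orthonormal_poly_mult_integrable:
  assumes "orthonormal_polys M p" "sets M = sets borel"
  shows "integrable M (\<lambda>x. poly f x * poly g x)"
  by (rule integrable_mult_of_squares)
     (simp_all add: orthonormal_poly_square_integrable[OF assms] poly_borel_measurable[OF assms(2)])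

lemma orthonormal_lower_degree:
  assumes on: "orthonormal_polys M p" and M: "sets M = sets borel"
    and "f = 0 \<or> degree f < n"
  shows "(\<integral>x. poly f x * poly (p n) x \<partial>M) = 0"
  using orthonormal_degree[OF on] assms(3)
proof (induction f rule: graded_poly_induct)
  case zero
  then show ?case by simp
next
  case (step m c r)
  have pm: "degree (p m) = m" "p m \<noteq> 0"
    using orthonormal_degree[OF on] by (metis, metis leading_coeff_0_iff less_irrefl)
  have "smult c (p m) + r \<noteq> 0"
  proof
    assume "smult c (p m) + r = 0"
    then have "r = smult (- c) (p m)"
      by (simp add: eq_neg_iff_add_eq_0 add.commute)
    with pm step(2,3) show False
      by auto
  qed
  with step(4,5) have m: "m < n"
    by simp
  with step have r: "r = 0 \<or> degree r < n"
    using orthonormal_degree[OF on] by fastforce+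
  have "(\<integral>x. poly (smult c (p m) + r) x * poly (p n) x \<partial>M) =
      (\<integral>x. c * (poly (p m) x * poly (p n) x) + poly r x * poly (p n) x \<partial>M)"
    by (simp add: algebra_simps)
  also have "\<dots> = c * (\<integral>x. poly (p m) x * poly (p n) x \<partial>M) + (\<integral>x. poly r x * poly (p n) x \<partial>M)"
    using orthonormal_poly_mult_integrable[OF on M] by simp
  also have "\<dots> = 0"
    using m step.IH[OF r] orthonormal_integral[OF on, of m n] by simp
  finally show ?case .
qed

text \<open>
  A multiple \<open>c p\<^sub>n\<close> differs from \<open>q\<^sub>n\<close> by a polynomial \<open>r\<close> of lower degree, which is orthogonal to
  both; comparing norms gives \<open>c\<^sup>2 = 1\<close>, and positivity of the leading coefficients gives
  \<open>c = 1\<close>. This lets the recursion, which \<open>jacobi_parameters\<close> asserts for some orthonormal system,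
  be used for the given one.
\<close>

lemma orthonormal_polys_unique:
  assumes on: "orthonormal_polys M p" "orthonormal_polys M q" and M: "sets M = sets borel"
  shows "p = q"
proof
  fix n
  define c where "c = lead_coeff (q n) / lead_coeff (p n)"
  define r where "r = q n - smult c (p n)"
  have pn: "degree (p n) = n" "lead_coeff (p n) > 0" and qn: "degree (q n) = n" "lead_coeff (q n) > 0"
    using on orthonormal_degree by blast+
  have c: "c > 0"
    using pn qn by (simp add: c_def)
  have "degree r \<le> n"
    unfolding r_def using pn qn by (intro degree_diff_le) auto
  moreover have "coeff r n = 0"
    using pn qn by (simp add: r_def c_def)
  ultimately have r: "r = 0 \<or> degree r < n"
    by (rule eq_zero_or_degree_less)
  have q: "q n = smult c (p n) + r"
    by (simp add: r_def)
  note int = orthonormal_poly_mult_integrable[OF on(1) M]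
  have "1 = (\<integral>x. poly (q n) x * poly (q n) x \<partial>M)"
    using orthonormal_integral[OF on(2), of n n] by simp
  also have "\<dots> = (\<integral>x. c * (poly (p n) x * poly (q n) x) + poly r x * poly (q n) x \<partial>M)"
    by (subst q) (simp add: algebra_simps)
  also have "\<dots> = c * (\<integral>x. poly (p n) x * poly (q n) x \<partial>M) + (\<integral>x. poly r x * poly (q n) x \<partial>M)"
    using int by simp
  also have "(\<integral>x. poly r x * poly (q n) x \<partial>M) = 0"
    using orthonormal_lower_degree[OF on(2) M r] .
  also have "(\<integral>x. poly (p n) x * poly (q n) x \<partial>M) =
      (\<integral>x. c * (poly (p n) x * poly (p n) x) + poly r x * poly (p n) x \<partial>M)"
    by (subst q) (simp add: algebra_simps)
  also have "\<dots> = c * (\<integral>x. poly (p n) x * poly (p n) x \<partial>M) + (\<integral>x. poly r x * poly (p n) x \<partial>M)"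
    using int by simp
  also have "\<dots> = c"
    using orthonormal_lower_degree[OF on(1) M r] orthonormal_integral[OF on(1), of n n] by simp
  finally have "c\<^sup>2 = 1"
    by (simp add: power2_eq_square)
  then have c1: "c = 1"
    using c by (simp add: power2_eq_1_iff)
  show "p n = q n"
  proof (rule ccontr)
    \<comment> \<open>If \<open>r\<close> has degree \<open>m\<close>, its inner product with \<open>p\<^sub>m\<close> is a nonzero ratio of leading
      coefficients, although \<open>p\<^sub>n\<close> and \<open>q\<^sub>n\<close> are both orthogonal to \<open>p\<^sub>m\<close>.\<close>
    assume "p n \<noteq> q n"
    then have r0: "r \<noteq> 0"
      by (simp add: r_def c1)
    define m where "m = degree r"
    have m: "m < n"
      using r r0 by (simp add: m_def)
    define d where "d = lead_coeff r / lead_coeff (p m)"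
    define s where "s = r - smult d (p m)"
    have pm: "degree (p m) = m" "lead_coeff (p m) > 0"
      using on orthonormal_degree by blast+
    have d: "d \<noteq> 0"
      using r0 pm by (simp add: d_def)
    have "degree s \<le> m"
      unfolding s_def using pm by (intro degree_diff_le) (auto simp: m_def)
    moreover have "coeff s m = 0"
      using pm by (simp add: s_def d_def m_def)
    ultimately have s: "s = 0 \<or> degree s < m"
      by (rule eq_zero_or_degree_less)
    have "(\<integral>x. poly r x * poly (p m) x \<partial>M) =
        (\<integral>x. d * (poly (p m) x * poly (p m) x) + poly s x * poly (p m) x \<partial>M)"
      by (simp add: s_def algebra_simps)
    also have "\<dots> = d * (\<integral>x. poly (p m) x * poly (p m) x \<partial>M) + (\<integral>x. poly s x * poly (p m) x \<partial>M)"
      using int by simp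
    also have "\<dots> = d"
      using orthonormal_lower_degree[OF on(1) M s] orthonormal_integral[OF on(1), of m m] by simp
    finally have "(\<integral>x. poly r x * poly (p m) x \<partial>M) = d" .
    moreover have "(\<integral>x. poly r x * poly (p m) x \<partial>M) =
        (\<integral>x. poly (p m) x * poly (q n) x - poly (p m) x * poly (p n) x \<partial>M)"
      by (simp add: r_def c1 algebra_simps)
    moreover have "\<dots> = (\<integral>x. poly (p m) x * poly (q n) x \<partial>M) - (\<integral>x. poly (p m) x * poly (p n) x \<partial>M)"
      using int by simp
    moreover have "\<dots> = 0"
      using orthonormal_lower_degree[OF on(2) M, of "p m" n] orthonormal_integral[OF on(1), of m n] pm m
      by simp
    ultimately show False
      using d by simp
  qed
qed

definition cpoly :: "real poly \<Rightarrow> complex \<Rightarrow> complex" where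
  "cpoly f z = poly (map_poly complex_of_real f) z"

lemma cpoly_0 [simp]: "cpoly 0 z = 0"
  by (simp add: cpoly_def)

lemma cpoly_pCons [simp]: "cpoly (pCons c f) z = of_real c + z * cpoly f z"
  by (simp add: cpoly_def map_poly_pCons)

lemma cpoly_1 [simp]: "cpoly 1 z = 1"
  by (simp add: one_pCons)

lemma cpoly_add [simp]: "cpoly (f + g) z = cpoly f z + cpoly g z"
  by (induction f g rule: poly_induct2) (simp_all add: algebra_simps)

lemma cpoly_smult [simp]: "cpoly (smult c f) z = of_real c * cpoly f z"
  by (induction f) (simp_all add: algebra_simps)

lemma cpoly_of_real [simp]: "cpoly f (of_real t) = of_real (poly f t)"
  by (induction f) simp_all

lemma holomorphic_cpoly [holomorphic_intros]:
  "g holomorphic_on A \<Longrightarrow> (\<lambda>z. cpoly f (g z)) holomorphic_on A"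
  unfolding cpoly_def by (intro holomorphic_intros)

section \<open>Solutions of the Jacobi recursion and their Wronskians\<close>

definition jacobi_recursion ::
    "(nat \<Rightarrow> real poly) \<Rightarrow> (nat \<Rightarrow> real) \<Rightarrow> (nat \<Rightarrow> real) \<Rightarrow> bool" where
  "jacobi_recursion p a b \<longleftrightarrow>
     [:0, 1:] * p 0 = smult (a 1) (p 1) + smult (b 1) (p 0) \<and>
     (\<forall>n\<ge>1. [:0, 1:] * p n =
        smult (a (n + 1)) (p (n + 1)) + smult (b (n + 1)) (p n) + smult (a n) (p (n - 1)))"

lemma jacobi_parameters_recursion:
  assumes "orthonormal_polys M p" "jacobi_parameters M a b" "sets M = sets borel"
  shows "jacobi_recursion p a b"
  using assms orthonormal_polys_unique[OF assms(1) _ assms(3)]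
  unfolding jacobi_parameters_def jacobi_recursion_def by blast

lemma orthonormal_poly_zero:
  assumes "prob_space M" "orthonormal_polys M p"
  shows "p 0 = 1"
proof -
  interpret prob_space M by fact
  have p0: "degree (p 0) = 0" "lead_coeff (p 0) > 0"
    using orthonormal_degree[OF assms(2)] by blast+
  then obtain c where c: "p 0 = [:c:]"
    by (meson degree_eq_zeroE)
  have "c > 0"
    using p0 c by simp
  moreover have "c * c = 1"
    using orthonormal_integral[OF assms(2), of 0 0] c prob_space by simp
  ultimately have "c = 1"
    using square_eq_1_iff[of c] by auto
  then show ?thesis
    using c by (simp add: one_pCons)
qed

text \<open>
  Only the lines \<open>n \<ge> 1\<close> of the recursion are imposed, so that the solutions form a plane,
  which contains the polynomials as well as the second solution and does not depend on \<open>b 1\<close>.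
\<close>

definition three_term ::
    "(nat \<Rightarrow> real) \<Rightarrow> (nat \<Rightarrow> real) \<Rightarrow> complex \<Rightarrow> (nat \<Rightarrow> complex) \<Rightarrow> bool" where
  "three_term a b z u \<longleftrightarrow>
     (\<forall>n\<ge>1. z * u n = of_real (a (n + 1)) * u (n + 1) + of_real (b (n + 1)) * u n +
        of_real (a n) * u (n - 1))"

text \<open>
  Meaningful for \<open>n \<ge> 1\<close>. It is the area form on the pairs \<open>(u\<^sub>n, u\<^sub>n\<^sub>-\<^sub>1)\<close>, scaled so as to be
  independent of \<open>n\<close> for two solutions at the same spectral parameter.
\<close>

definition wronskian :: "(nat \<Rightarrow> real) \<Rightarrow> nat \<Rightarrow> (nat \<Rightarrow> complex) \<Rightarrow> (nat \<Rightarrow> complex) \<Rightarrow> complex" where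
  "wronskian a n u v = of_real (a n) * (u n * v (n - 1) - u (n - 1) * v n)"

lemma wronskian_linear:
  "wronskian a n (\<lambda>j. c * u j + d * u' j) v = c * wronskian a n u v + d * wronskian a n u' v"
  by (simp add: wronskian_def algebra_simps)

text \<open>
  Four vectors in the plane satisfy the Pluecker relation. It recovers the Wronskian of any two
  solutions from their Wronskians with two fixed solutions \<open>s\<close> and \<open>t\<close>.
\<close>

lemma wronskian_plucker:
  "wronskian a n u v * wronskian a n s t =
     wronskian a n u s * wronskian a n v t - wronskian a n u t * wronskian a n v s"
  by (simp add: wronskian_def algebra_simps)

lemma three_term_linear:
  "three_term a b z u \<Longrightarrow> three_term a b z u' \<Longrightarrow> three_term a b z (\<lambda>j. c * u j + d * u' j)"
  unfolding three_term_def
proof (intro allI impI, goal_cases)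
  case (1 n)
  then have "c * (z * u n) + d * (z * u' n) =
      c * (of_real (a (n + 1)) * u (n + 1) + of_real (b (n + 1)) * u n + of_real (a n) * u (n - 1)) +
      d * (of_real (a (n + 1)) * u' (n + 1) + of_real (b (n + 1)) * u' n + of_real (a n) * u' (n - 1))"
    by simp
  then show ?case
    by (simp add: algebra_simps)
qed

text \<open>
  The Wronskian of solutions at \<open>x\<close> and \<open>y\<close> grows by \<open>(x - y) u\<^sub>j v\<^sub>j\<close> from \<open>j\<close> to \<open>j + 1\<close>.
\<close>

lemma christoffel_darboux:
  assumes u: "three_term a b x u" and v: "three_term a b y v" and "1 \<le> n"
  shows "wronskian a n u v = wronskian a 1 u v + (x - y) * (\<Sum>j=1..<n. u j * v j)"
  using \<open>1 \<le> n\<close>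
proof (induction n rule: dec_induct)
  case base
  then show ?case by simp
next
  case (step n)
  have "x * u n = of_real (a (n + 1)) * u (n + 1) + of_real (b (n + 1)) * u n + of_real (a n) * u (n - 1)"
    "y * v n = of_real (a (n + 1)) * v (n + 1) + of_real (b (n + 1)) * v n + of_real (a n) * v (n - 1)"
    using u v step(1) by (simp_all add: three_term_def)
  then have "(x * u n) * v n - u n * (y * v n) =
      (of_real (a (n + 1)) * u (n + 1) + of_real (b (n + 1)) * u n + of_real (a n) * u (n - 1)) * v n -
      u n * (of_real (a (n + 1)) * v (n + 1) + of_real (b (n + 1)) * v n + of_real (a n) * v (n - 1))"
    by simp
  then have "(x - y) * (u n * v n) = wronskian a (Suc n) u v - wronskian a n u v"
    by (simp add: wronskian_def algebra_simps)
  then show ?case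
    using step by (simp add: algebra_simps)
qed

fun second_kind :: "(nat \<Rightarrow> real) \<Rightarrow> (nat \<Rightarrow> real) \<Rightarrow> complex \<Rightarrow> nat \<Rightarrow> complex" where
  "second_kind a b z 0 = 0"
| "second_kind a b z (Suc 0) = 1 / of_real (a 1)"
| "second_kind a b z (Suc (Suc n)) =
     ((z - of_real (b (n + 2))) * second_kind a b z (Suc n) - of_real (a (n + 1)) * second_kind a b z n)
       / of_real (a (n + 2))"

lemma three_term_second_kind:
  assumes "\<forall>n\<ge>1. a n > 0"
  shows "three_term a b z (second_kind a b z)"
  unfolding three_term_def
proof (intro allI impI)
  fix n :: nat
  assume "n \<ge> 1"
  then obtain m where n: "n = Suc m"
    using not0_implies_Suc by force
  have "a (n + 1) \<noteq> 0"
    using assms by (metis le_add2 less_irrefl)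
  then show "z * second_kind a b z n = of_real (a (n + 1)) * second_kind a b z (n + 1) +
      of_real (b (n + 1)) * second_kind a b z n + of_real (a n) * second_kind a b z (n - 1)"
    by (simp add: n field_simps)
qed

lemma three_term_cpoly:
  assumes "jacobi_recursion p a b"
  shows "three_term a b z (\<lambda>n. cpoly (p n) z)"
  unfolding three_term_def
proof (intro allI impI)
  fix n :: nat
  assume "n \<ge> 1"
  then have "cpoly ([:0, 1:] * p n) z =
      cpoly (smult (a (n + 1)) (p (n + 1)) + smult (b (n + 1)) (p n) + smult (a n) (p (n - 1))) z"
    using assms unfolding jacobi_recursion_def by metis
  then show "z * cpoly (p n) z = of_real (a (n + 1)) * cpoly (p (n + 1)) z +
      of_real (b (n + 1)) * cpoly (p n) z + of_real (a n) * cpoly (p (n - 1)) z"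
    by simp
qed

lemma cpoly_jacobi_one:
  assumes "jacobi_recursion p a b" "p 0 = 1"
  shows "of_real (a 1) * cpoly (p 1) z = z - of_real (b 1)"
proof -
  have "cpoly ([:0, 1:] * p 0) z = cpoly (smult (a 1) (p 1) + smult (b 1) (p 0)) z"
    using assms(1) unfolding jacobi_recursion_def by metis
  then show ?thesis
    using assms(2) by (simp add: algebra_simps)
qed

lemma three_term_unique:
  assumes u: "three_term a b z u" and v: "three_term a b z v" and a: "\<forall>n\<ge>1. a n > 0"
    and "u 0 = v 0" "u 1 = v 1"
  shows "u n = v n"
proof -
  have "u n = v n \<and> u (Suc n) = v (Suc n)"
  proof (induction n)
    case 0
    then show ?case using assms by simp
  next
    case (Suc n)
    have "z * u (Suc n) = of_real (a (n + 2)) * u (n + 2) + of_real (b (n + 2)) * u (Suc n) + of_real (a (Suc n)) * u n"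
      "z * v (Suc n) = of_real (a (n + 2)) * v (n + 2) + of_real (b (n + 2)) * v (Suc n) + of_real (a (Suc n)) * v n"
      using u v unfolding three_term_def by (force dest: spec[of _ "Suc n"])+
    moreover have "a (n + 2) > 0"
      using a by simp
    ultimately show ?case
      using Suc by simp
  qed
  then show ?thesis ..
qed

lemma second_kind_first_coefficient:
  assumes "\<And>n. n \<ge> 2 \<Longrightarrow> b n = b' n"
  shows "second_kind a b z n = second_kind a b' z n"
  using assms by (induction a b z n rule: second_kind.induct) simp_all

text \<open>
  Adding \<open>\<beta>\<close> to the first diagonal entry changes the recursion only in its first line, and
  subtracting \<open>\<beta>\<close> times the second solution from \<open>p\<close> makes up for that line.
\<close>

lemma perturbed_polynomials:
  assumes p: "jacobi_recursion p a b" "p 0 = 1" and a: "\<forall>n\<ge>1. a n > 0"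
    and q: "jacobi_recursion q a (\<lambda>n. b n + \<beta> * (if n = 1 then 1 else 0))" "q 0 = 1"
  shows "cpoly (q n) z = cpoly (p n) z - of_real \<beta> * second_kind a b z n"
proof -
  let ?b = "\<lambda>n. b n + \<beta> * (if n = 1 then 1 else 0)"
  have sk: "second_kind a ?b z = second_kind a b z"
    by (rule ext, rule second_kind_first_coefficient) simp
  have a1: "a 1 \<noteq> 0"
    using a by force
  have "three_term a ?b z (\<lambda>n. 1 * cpoly (p n) z + (- of_real \<beta>) * second_kind a b z n)"
  proof (rule three_term_linear)
    show "three_term a ?b z (\<lambda>n. cpoly (p n) z)"
      using three_term_cpoly[OF p(1)] by (simp add: three_term_def)
    show "three_term a ?b z (second_kind a b z)"
      using three_term_second_kind[OF a, of ?b z] sk by simp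
  qed
  moreover have "of_real (a 1) * cpoly (q 1) z =
      of_real (a 1) * (cpoly (p 1) z - of_real \<beta> * second_kind a b z 1)"
    using cpoly_jacobi_one[OF p, of z] cpoly_jacobi_one[OF q, of z] a1
    by (simp add: right_diff_distrib)
  ultimately have "cpoly (q n) z = 1 * cpoly (p n) z + (- of_real \<beta>) * second_kind a b z n"
    using p(2) q(2) a1
    by - (rule three_term_unique[OF three_term_cpoly[OF q(1)] _ a,
        where v = "\<lambda>n. 1 * cpoly (p n) z + (- of_real \<beta>) * second_kind a b z n"], simp_all)
  then show ?thesis
    by simp
qed

lemma wronskian_pp:
  assumes "jacobi_recursion p a b" "p 0 = 1" "1 \<le> n"
  shows "wronskian a n (\<lambda>j. cpoly (p j) x) (\<lambda>j. cpoly (p j) y) = (x - y) * cd_kernel p n x y"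
proof -
  have "wronskian a 1 (\<lambda>j. cpoly (p j) x) (\<lambda>j. cpoly (p j) y) = x - y"
    using cpoly_jacobi_one[OF assms(1,2), of x] cpoly_jacobi_one[OF assms(1,2), of y] assms(2)
    by (simp add: wronskian_def right_diff_distrib)
  moreover have "cd_kernel p n x y = 1 + (\<Sum>j=1..<n. cpoly (p j) x * cpoly (p j) y)"
    using assms(2,3)
    by (simp add: cd_kernel_def cpoly_def[symmetric] lessThan_atLeast0 sum.atLeast_Suc_lessThan)
  ultimately show ?thesis
    using christoffel_darboux[OF three_term_cpoly three_term_cpoly, OF assms(1,1,3), of x y]
    by (simp add: algebra_simps)
qed

lemma wronskian_qp:
  assumes "jacobi_recursion p a b" "p 0 = 1" "1 \<le> n" and a: "\<forall>n\<ge>1. a n > 0"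
  shows "wronskian a n (second_kind a b x) (\<lambda>j. cpoly (p j) y) =
     1 + (x - y) * (\<Sum>j<n. second_kind a b x j * cpoly (p j) y)"
proof -
  have "a 1 \<noteq> 0"
    using a by force
  then have "wronskian a 1 (second_kind a b x) (\<lambda>j. cpoly (p j) y) = 1"
    using assms(2) by (simp add: wronskian_def algebra_simps)
  moreover have "(\<Sum>j<n. second_kind a b x j * cpoly (p j) y) =
      (\<Sum>j=1..<n. second_kind a b x j * cpoly (p j) y)"
    using assms(3) by (simp add: lessThan_atLeast0 sum.atLeast_Suc_lessThan)
  ultimately show ?thesis
    using christoffel_darboux[OF three_term_second_kind[OF a] three_term_cpoly[OF assms(1)] assms(3),
        of x y]
    by (simp add: algebra_simps)
qed

lemma second_kind_cnj: "second_kind a b (cnj z) n = cnj (second_kind a b z n)"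
  by (induction a b z n rule: second_kind.induct) simp_all

lemma holomorphic_second_kind [holomorphic_intros]:
  assumes "g holomorphic_on A"
  shows "(\<lambda>z. second_kind a b (g z) n) holomorphic_on A"
proof (induction n rule: less_induct)
  case (less n)
  consider "n = 0" | "n = Suc 0" | m where "n = Suc (Suc m)"
    by (metis not0_implies_Suc)
  then show ?case
  proof cases
    case 3
    then show ?thesis
      using less[of m] less[of "Suc m"] assms
      by (simp only: second_kind.simps divide_inverse) (intro holomorphic_intros; simp)
  qed simp_all
qed

section \<open>The Stieltjes transform and the Weyl solution\<close>

lemma cauchy_kernel_measurable:
  assumes "sets M = sets borel"
  shows "(\<lambda>t. 1 / (complex_of_real t - z)) \<in> borel_measurable M"
  by (subst measurable_cong_sets[OF assms refl]) measurable

lemma cauchy_kernel_bound: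
  assumes "Im z \<noteq> 0"
  shows "cmod (1 / (complex_of_real t - z)) \<le> 1 / \<bar>Im z\<bar>"
proof -
  have "\<bar>Im z\<bar> \<le> cmod (complex_of_real t - z)"
    using abs_Im_le_cmod[of "complex_of_real t - z"] by simp
  then show ?thesis
    using assms by (simp add: norm_divide frac_le)
qed

lemma cauchy_kernel_mult_integrable:
  fixes f :: "real \<Rightarrow> complex"
  assumes M: "sets M = sets borel" and z: "Im z \<noteq> 0" and f: "integrable M f"
  shows "integrable M (\<lambda>t. f t * (1 / (complex_of_real t - z)))"
proof (rule Bochner_Integration.integrable_bound)
  show "integrable M (\<lambda>t. f t * of_real (1 / \<bar>Im z\<bar>))"
    using f by simp
  show "(\<lambda>t. f t * (1 / (complex_of_real t - z))) \<in> borel_measurable M"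
    using f cauchy_kernel_measurable[OF M] by (intro borel_measurable_times) auto
  show "AE t in M. cmod (f t * (1 / (complex_of_real t - z))) \<le> cmod (f t * of_real (1 / \<bar>Im z\<bar>))"
    using mult_left_mono[OF cauchy_kernel_bound[OF z]] by (simp add: norm_mult norm_divide)
qed

context real_distribution
begin

lemma cauchy_kernel_integrable:
  assumes "Im z \<noteq> 0"
  shows "integrable M (\<lambda>t. 1 / (complex_of_real t - z))"
  using cauchy_kernel_mult_integrable[OF events_eq_borel assms, of "\<lambda>_. 1"] by simp

lemma cauchy_kernel2_integrable:
  assumes "Im z \<noteq> 0" "Im z' \<noteq> 0"
  shows "integrable M (\<lambda>t. 1 / (complex_of_real t - z) * (1 / (complex_of_real t - z')))"
  using assms by (intro cauchy_kernel_mult_integrable[OF events_eq_borel] cauchy_kernel_integrable)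

lemma cauchy_kernel_square_integrable:
  assumes "Im z \<noteq> 0"
  shows "integrable M (\<lambda>t. (cmod (1 / (complex_of_real t - z)))\<^sup>2)"
  using integrable_norm[OF cauchy_kernel2_integrable[OF assms assms]]
  by (simp add: norm_mult norm_divide power2_eq_square)

lemma Im_stieltjes:
  assumes z: "Im z \<noteq> 0"
  shows "Im (stieltjes M z) = Im z * (\<integral>t. (cmod (1 / (complex_of_real t - z)))\<^sup>2 \<partial>M)"
proof -
  have "Im (stieltjes M z) = (\<integral>t. Im (1 / (complex_of_real t - z)) \<partial>M)"
    unfolding stieltjes_def
    by (rule integral_Im[OF cauchy_kernel_integrable[OF z], symmetric])
  also have "(\<lambda>t. Im (1 / (complex_of_real t - z))) =
      (\<lambda>t. Im z * (cmod (1 / (complex_of_real t - z)))\<^sup>2)"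
    by (simp add: Im_divide cmod_power2 norm_divide power_divide)
  finally show ?thesis
    by simp
qed

lemma Im_stieltjes_nonneg:
  assumes "Im z > 0"
  shows "0 \<le> Im (stieltjes M z)"
  using assms by (simp add: Im_stieltjes)

lemma stieltjes_diff:
  assumes z: "Im z \<noteq> 0" "Im z' \<noteq> 0"
  shows "stieltjes M z - stieltjes M z' =
     (z - z') * (\<integral>t. 1 / (complex_of_real t - z) * (1 / (complex_of_real t - z')) \<partial>M)"
proof -
  have "stieltjes M z - stieltjes M z' =
      (\<integral>t. 1 / (complex_of_real t - z) - 1 / (complex_of_real t - z') \<partial>M)"
    unfolding stieltjes_def
    by (rule Bochner_Integration.integral_diff[symmetric])
       (intro cauchy_kernel_integrable z)+
  also have "\<dots> = (\<integral>t. (z - z') * (1 / (complex_of_real t - z) * (1 / (complex_of_real t - z'))) \<partial>M)"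
  proof (rule Bochner_Integration.integral_cong[OF refl])
    fix t
    have "complex_of_real t - z \<noteq> 0" "complex_of_real t - z' \<noteq> 0"
      using z by (auto simp: complex_eq_iff)
    then show "1 / (complex_of_real t - z) - 1 / (complex_of_real t - z') =
        (z - z') * (1 / (complex_of_real t - z) * (1 / (complex_of_real t - z')))"
      by (simp add: field_simps)
  qed
  finally show ?thesis
    by (simp only: integral_mult_right_zero)
qed

text \<open>
  Since \<open>\<bar>t - z'\<bar> \<le> \<bar>t - z\<bar> (1 + \<bar>z - z'\<bar> / Im z)\<close> for real \<open>t\<close>, the two kernels are comparable, and
  \<open>\<integral> \<bar>t - z'\<bar>\<^sup>-\<^sup>2 d\<mu>\<close> is \<open>Im F(z') / Im z'\<close>. The bound does not change when \<open>z\<close> and \<open>z'\<close> are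
  rescaled about a real point, so it is uniform in \<open>n\<close> at the scale \<open>1 / n\<close>.
\<close>

lemma stieltjes_harnack:
  assumes z: "Im z > 0" "Im z' > 0"
  shows "cmod (stieltjes M z - stieltjes M z') \<le>
     cmod (z - z') * ((1 + cmod (z - z') / Im z) * (Im (stieltjes M z') / Im z'))"
proof -
  define k where "k = 1 + cmod (z - z') / Im z"
  have "cmod (\<integral>t. 1 / (complex_of_real t - z) * (1 / (complex_of_real t - z')) \<partial>M) \<le>
      (\<integral>t. cmod (1 / (complex_of_real t - z) * (1 / (complex_of_real t - z'))) \<partial>M)"
    by (rule integral_norm_bound)
  also have "\<dots> \<le> (\<integral>t. k * (cmod (1 / (complex_of_real t - z')))\<^sup>2 \<partial>M)"
  proof (rule integral_mono)
    show "integrable M (\<lambda>t. cmod (1 / (complex_of_real t - z) * (1 / (complex_of_real t - z'))))"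
      using cauchy_kernel2_integrable[of z z'] z by (intro integrable_norm) simp
    show "integrable M (\<lambda>t. k * (cmod (1 / (complex_of_real t - z')))\<^sup>2)"
      using cauchy_kernel_square_integrable[of z'] z by simp
    fix t
    have nz: "complex_of_real t - z \<noteq> 0" "complex_of_real t - z' \<noteq> 0"
      using z by (auto simp: complex_eq_iff)
    have "Im z \<le> cmod (complex_of_real t - z)"
      using abs_Im_le_cmod[of "complex_of_real t - z"] z by simp
    then have "cmod (z - z') \<le> cmod (z - z') / Im z * cmod (complex_of_real t - z)"
      using z mult_left_mono[of "Im z" "cmod (complex_of_real t - z)" "cmod (z - z') / Im z"] by simp
    moreover have "cmod (complex_of_real t - z') \<le> cmod (complex_of_real t - z) + cmod (z - z')"
      using norm_triangle_ineq[of "complex_of_real t - z" "z - z'"] by simp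
    ultimately have "cmod (complex_of_real t - z') \<le> k * cmod (complex_of_real t - z)"
      by (simp add: k_def algebra_simps)
    then have "1 / cmod (complex_of_real t - z) \<le> k * (1 / cmod (complex_of_real t - z'))"
      using nz by (simp add: field_simps)
    then have "1 / cmod (complex_of_real t - z) * (1 / cmod (complex_of_real t - z')) \<le>
        k * (1 / cmod (complex_of_real t - z')) * (1 / cmod (complex_of_real t - z'))"
      by (intro mult_right_mono) auto
    then show "cmod (1 / (complex_of_real t - z) * (1 / (complex_of_real t - z'))) \<le>
        k * (cmod (1 / (complex_of_real t - z')))\<^sup>2"
      by (simp add: norm_mult norm_divide power2_eq_square)
  qed
  also have "\<dots> = k * (Im (stieltjes M z') / Im z')"
    using z by (simp add: Im_stieltjes)
  finally have "cmod (\<integral>t. 1 / (complex_of_real t - z) * (1 / (complex_of_real t - z')) \<partial>M) \<le>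
      k * (Im (stieltjes M z') / Im z')" .
  moreover have "stieltjes M z - stieltjes M z' =
      (z - z') * (\<integral>t. 1 / (complex_of_real t - z) * (1 / (complex_of_real t - z')) \<partial>M)"
    using z by (intro stieltjes_diff) auto
  ultimately show ?thesis
    unfolding k_def by (simp only: norm_mult mult_left_mono norm_ge_zero)
qed

lemma stieltjes_holomorphic:
  shows "stieltjes M holomorphic_on {z. Im z > 0}"
proof (rule holomorphic_onI)
  fix z0 :: complex
  assume "z0 \<in> {z. Im z > 0}"
  then have z0: "Im z0 > 0" by simp
  let ?I = "\<lambda>z. \<integral>t. 1 / (complex_of_real t - z) * (1 / (complex_of_real t - z0)) \<partial>M"
  have "(?I \<longlongrightarrow> ?I z0) (at z0)"
  proof (rule Lim_null_comparison[THEN LIM_zero_cancel])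
    have "open {z. Im z > Im z0 / 2}"
      by (rule open_halfspace_Im_gt)
    then have "eventually (\<lambda>z. z \<in> {z. Im z > Im z0 / 2}) (at z0)"
      using z0 by (intro eventually_at_in_open') auto
    then show "\<forall>\<^sub>F z in at z0. cmod (?I z - ?I z0) \<le> cmod (z - z0) * (2 / (Im z0 ^ 3))"
    proof eventually_elim
      case (elim z)
      then have z: "Im z > 0" "Im z > Im z0 / 2" using z0 by auto
      have int: "integrable M (\<lambda>t. 1 / (complex_of_real t - z) * (1 / (complex_of_real t - z0)))"
          "integrable M (\<lambda>t. 1 / (complex_of_real t - z0) * (1 / (complex_of_real t - z0)))"
        using z z0 by (intro cauchy_kernel2_integrable; simp)+
      have "?I z - ?I z0 = (\<integral>t. 1 / (complex_of_real t - z) * (1 / (complex_of_real t - z0)) -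
          1 / (complex_of_real t - z0) * (1 / (complex_of_real t - z0)) \<partial>M)"
        using int by simp
      also have "cmod \<dots> \<le> cmod (z - z0) * (2 / (Im z0 ^ 3))"
      proof (rule order_trans[OF integral_norm_bound], rule integral_le_const)
        show "integrable M (\<lambda>t. cmod (1 / (complex_of_real t - z) * (1 / (complex_of_real t - z0)) -
            1 / (complex_of_real t - z0) * (1 / (complex_of_real t - z0))))"
          using int by (intro integrable_norm Bochner_Integration.integrable_diff)
        have "cmod (1 / (complex_of_real t - z) * (1 / (complex_of_real t - z0)) -
            1 / (complex_of_real t - z0) * (1 / (complex_of_real t - z0))) \<le>
            cmod (z - z0) * (2 / (Im z0 ^ 3))" for t
        proof -
          let ?k = "1 / (complex_of_real t - z0)" and ?l = "1 / (complex_of_real t - z)"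
          have "complex_of_real t - z \<noteq> 0" "complex_of_real t - z0 \<noteq> 0"
            using z z0 by (auto simp: complex_eq_iff)
          then have "?l - ?k = (z - z0) * (?l * ?k)"
            by (simp add: field_simps)
          then have "?l * ?k - ?k * ?k = (z - z0) * (?l * (?k * ?k))"
            by (metis left_diff_distrib mult.assoc)
          moreover have "cmod ?k \<le> 1 / Im z0" "cmod ?l \<le> 2 / Im z0"
          proof -
            show "cmod ?k \<le> 1 / Im z0"
              using cauchy_kernel_bound[of z0 t] z0 by simp
            have "cmod ?l \<le> 1 / Im z"
              using cauchy_kernel_bound[of z t] z by simp
            also have "\<dots> \<le> 2 / Im z0"
              using z z0 by (simp add: field_simps)
            finally show "cmod ?l \<le> 2 / Im z0" .
          qed
          then have "cmod ?l * (cmod ?k * cmod ?k) \<le> 2 / Im z0 * (1 / Im z0 * (1 / Im z0))"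
            using z0 by (intro mult_mono) auto
          then have "cmod (z - z0) * (cmod ?l * (cmod ?k * cmod ?k)) \<le> cmod (z - z0) * (2 / Im z0 ^ 3)"
            by (intro mult_left_mono) (simp_all add: power3_eq_cube)
          ultimately show ?thesis
            by (simp only: norm_mult)
        qed
        then show "AE t in M. cmod (1 / (complex_of_real t - z) * (1 / (complex_of_real t - z0)) -
            1 / (complex_of_real t - z0) * (1 / (complex_of_real t - z0))) \<le>
            cmod (z - z0) * (2 / (Im z0 ^ 3))"
          by simp
      qed
      finally show ?case .
    qed
    have "((\<lambda>z. cmod (z - z0) * c) \<longlongrightarrow> cmod (z0 - z0) * c) (at z0)" for c
      by (intro tendsto_intros)
    from this[of "2 / (Im z0 ^ 3)"]
    show "((\<lambda>z. cmod (z - z0) * (2 / (Im z0 ^ 3))) \<longlongrightarrow> 0) (at z0)"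
      by (simp only: diff_self norm_zero mult_zero_left)
  qed
  then have "((\<lambda>z. (stieltjes M z - stieltjes M z0) / (z - z0)) \<longlongrightarrow> ?I z0) (at z0)"
  proof (rule Lim_transform_eventually)
    have "eventually (\<lambda>z. z \<in> {z. Im z > 0} - {z0}) (at z0)"
      using z0 open_halfspace_Im_gt[of 0] by (intro eventually_at_in_open) auto
    then show "\<forall>\<^sub>F z in at z0. ?I z = (stieltjes M z - stieltjes M z0) / (z - z0)"
    proof eventually_elim
      case (elim z)
      then show ?case
        using z0 by (simp add: stieltjes_diff)
    qed
  qed
  then have "(stieltjes M has_field_derivative ?I z0) (at z0 within {z. Im z > 0})"
    unfolding has_field_derivative_iff by (rule tendsto_within_subset) simp
  then show "stieltjes M field_differentiable at z0 within {z. Im z > 0}"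
    by (auto simp: field_differentiable_def)
qed

text \<open>
  Expand \<open>\<integral> (f - g)\<^sup>2 \<ge> 0\<close>, where \<open>g\<close> is the orthogonal projection of \<open>f\<close> onto the first \<open>n\<close>
  polynomials.
\<close>

lemma bessel_inequality:
  fixes f :: "real \<Rightarrow> real"
  assumes on: "orthonormal_polys M p"
    and f: "f \<in> borel_measurable M" "integrable M (\<lambda>t. f t * f t)"
  shows "(\<Sum>j<n. (\<integral>t. poly (p j) t * f t \<partial>M)\<^sup>2) \<le> (\<integral>t. f t * f t \<partial>M)"
proof -
  define c where "c j = (\<integral>t. poly (p j) t * f t \<partial>M)" for j
  define g where "g = (\<Sum>j<n. smult (c j) (p j))"
  have pg: "poly g t = (\<Sum>j<n. c j * poly (p j) t)" for t
    by (simp add: g_def poly_sum)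
  have int_pf: "integrable M (\<lambda>t. poly h t * f t)" for h
    by (rule integrable_mult_of_squares[OF poly_borel_measurable[OF events_eq_borel] f(1)
          orthonormal_poly_square_integrable[OF on events_eq_borel] f(2)])
  note int_pp = orthonormal_poly_mult_integrable[OF on events_eq_borel]
  have gf: "(\<integral>t. poly g t * f t \<partial>M) = (\<Sum>j<n. (c j)\<^sup>2)"
  proof -
    have "(\<integral>t. poly g t * f t \<partial>M) = (\<integral>t. (\<Sum>j<n. c j * (poly (p j) t * f t)) \<partial>M)"
      by (simp add: pg sum_distrib_right mult.assoc)
    also have "\<dots> = (\<Sum>j<n. c j * (\<integral>t. poly (p j) t * f t \<partial>M))"
      using int_pf by simp
    finally show ?thesis
      by (simp add: c_def power2_eq_square)
  qed
  have pjg: "(\<integral>t. poly (p j) t * poly g t \<partial>M) = c j" if "j < n" for j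
  proof -
    have "(\<integral>t. poly (p j) t * poly g t \<partial>M) =
        (\<integral>t. (\<Sum>i<n. c i * (poly (p j) t * poly (p i) t)) \<partial>M)"
      by (simp add: pg sum_distrib_left mult_ac)
    also have "\<dots> = (\<Sum>i<n. c i * (\<integral>t. poly (p j) t * poly (p i) t \<partial>M))"
      using int_pp by simp
    also have "\<dots> = c j"
      using that by (simp add: orthonormal_integral[OF on] if_distrib cong: if_cong)
    finally show ?thesis .
  qed
  have gg: "(\<integral>t. poly g t * poly g t \<partial>M) = (\<Sum>j<n. (c j)\<^sup>2)"
  proof -
    have "(\<integral>t. poly g t * poly g t \<partial>M) = (\<integral>t. (\<Sum>j<n. c j * (poly (p j) t * poly g t)) \<partial>M)"
      by (simp add: pg sum_distrib_right mult.assoc)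
    also have "\<dots> = (\<Sum>j<n. c j * (\<integral>t. poly (p j) t * poly g t \<partial>M))"
      using int_pp by simp
    also have "\<dots> = (\<Sum>j<n. (c j)\<^sup>2)"
      by (simp add: pjg power2_eq_square)
    finally show ?thesis .
  qed
  have "0 \<le> (\<integral>t. (f t - poly g t)\<^sup>2 \<partial>M)"
    by simp
  also have "\<dots> = (\<integral>t. f t * f t - 2 * (poly g t * f t) + poly g t * poly g t \<partial>M)"
    by (simp add: power2_eq_square algebra_simps)
  also have "\<dots> = (\<integral>t. f t * f t \<partial>M) - 2 * (\<integral>t. poly g t * f t \<partial>M) + (\<integral>t. poly g t * poly g t \<partial>M)"
    using f int_pf int_pp by simp
  finally show ?thesis
    by (simp add: gf gg c_def)
qed

text \<open>
  The Stieltjes transform of \<open>f d\<mu>\<close>. Along an orthonormal system, \<open>n \<mapsto> weyl (p n) z\<close> is the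
  Weyl solution of the Jacobi recursion, the one that is square summable.
\<close>

definition weyl :: "real poly \<Rightarrow> complex \<Rightarrow> complex" where
  "weyl f z = (\<integral>t. complex_of_real (poly f t) * (1 / (complex_of_real t - z)) \<partial>M)"

text \<open>
  The numbers \<open>weyl (p j) z\<close> are the Fourier coefficients of \<open>t \<mapsto> 1 / (t - z)\<close>, whose norm in
  \<open>L\<^sup>2(\<mu>)\<close> is given by the imaginary part of the Stieltjes transform.
\<close>

lemma weyl_square_summable:
  assumes on: "orthonormal_polys M p" and z: "Im z > 0"
  shows "(\<Sum>j<n. (cmod (weyl (p j) z))\<^sup>2) \<le> Im (stieltjes M z) / Im z"
proof -
  let ?k = "\<lambda>t. 1 / (complex_of_real t - z)"
  have k: "?k \<in> borel_measurable M"
    by (rule cauchy_kernel_measurable[OF events_eq_borel])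
  have k2: "integrable M (\<lambda>t. (cmod (?k t))\<^sup>2)"
    using cauchy_kernel_square_integrable z by simp
  have sq: "integrable M (\<lambda>t. Re (?k t) * Re (?k t))" "integrable M (\<lambda>t. Im (?k t) * Im (?k t))"
  proof -
    have "norm (Re w * Re w) \<le> norm ((cmod w)\<^sup>2)" "norm (Im w * Im w) \<le> norm ((cmod w)\<^sup>2)" for w
      unfolding cmod_power2 by (simp_all add: power2_eq_square)
    then show "integrable M (\<lambda>t. Re (?k t) * Re (?k t))" "integrable M (\<lambda>t. Im (?k t) * Im (?k t))"
      using k by (intro Bochner_Integration.integrable_bound[OF k2] AE_I2; measurable)+
  qed
  have int: "integrable M (\<lambda>t. complex_of_real (poly (p j) t) * ?k t)" for j
  proof (rule cauchy_kernel_mult_integrable[OF events_eq_borel])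
    show "integrable M (\<lambda>t. complex_of_real (poly (p j) t))"
      using orthonormal_poly_mult_integrable[OF on events_eq_borel, of "p j" 1] by simp
  qed (use z in simp)
  have "(cmod (weyl (p j) z))\<^sup>2 = (\<integral>t. poly (p j) t * Re (?k t) \<partial>M)\<^sup>2 + (\<integral>t. poly (p j) t * Im (?k t) \<partial>M)\<^sup>2"
    for j
    unfolding cmod_power2 weyl_def integral_Re[OF int[of j], symmetric] integral_Im[OF int[of j], symmetric]
    by (simp only: Re_complex_of_real Im_complex_of_real times_complex.sel mult_zero_left
        diff_zero add_0_right)
  then have "(\<Sum>j<n. (cmod (weyl (p j) z))\<^sup>2) =
      (\<Sum>j<n. (\<integral>t. poly (p j) t * Re (?k t) \<partial>M)\<^sup>2) + (\<Sum>j<n. (\<integral>t. poly (p j) t * Im (?k t) \<partial>M)\<^sup>2)"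
    by (simp add: sum.distrib)
  also have "\<dots> \<le> (\<integral>t. Re (?k t) * Re (?k t) \<partial>M) + (\<integral>t. Im (?k t) * Im (?k t) \<partial>M)"
    using k sq by (intro add_mono bessel_inequality[OF on]) auto
  also have "\<dots> = (\<integral>t. (cmod (?k t))\<^sup>2 \<partial>M)"
    unfolding cmod_power2 using sq by (simp add: power2_eq_square)
  also have "\<dots> = Im (stieltjes M z) / Im z"
    using z by (simp add: Im_stieltjes)
  finally show ?thesis .
qed

text \<open>
  Writing \<open>t / (t - z) = 1 + z / (t - z)\<close> transfers the recursion from the polynomials to their
  transforms; the extra term \<open>\<integral> p\<^sub>n d\<mu>\<close> vanishes except in the line \<open>n = 0\<close>.
\<close>

lemma weyl_three_term:
  assumes on: "orthonormal_polys M p"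
    and rec: "jacobi_recursion p a b" and p0: "p 0 = 1" and z: "Im z \<noteq> 0"
  shows "three_term a b z (\<lambda>n. weyl (p n) z)"
    and "weyl (p 0) z = stieltjes M z"
    and "of_real (a 1) * weyl (p 1) z = 1 + (z - of_real (b 1)) * stieltjes M z"
proof -
  have ints: "integrable M (\<lambda>t. poly f t)" for f
    using orthonormal_poly_mult_integrable[OF on events_eq_borel, of f 1] by simp
  then have int: "integrable M (\<lambda>t. complex_of_real (poly f t) * (1 / (complex_of_real t - z)))" for f
    using z by (intro cauchy_kernel_mult_integrable[OF events_eq_borel]) auto
  have add: "weyl (f + g) z = weyl f z + weyl g z" for f g
    unfolding weyl_def poly_add of_real_add distrib_right
    by (rule Bochner_Integration.integral_add[OF int int])
  have smult: "weyl (smult c f) z = of_real c * weyl f z" for c f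
    unfolding weyl_def poly_smult of_real_mult mult.assoc
    by (rule integral_mult_right_zero)
  have shift: "weyl ([:0, 1:] * f) z = of_real (\<integral>t. poly f t \<partial>M) + z * weyl f z" for f
  proof -
    have "complex_of_real (poly ([:0, 1:] * f) t) * (1 / (complex_of_real t - z)) =
        of_real (poly f t) + z * (of_real (poly f t) * (1 / (complex_of_real t - z)))" for t
    proof -
      have "complex_of_real t - z \<noteq> 0"
        using z by (auto simp: complex_eq_iff)
      then show ?thesis
        by (simp add: field_simps)
    qed
    then have "weyl ([:0, 1:] * f) z =
        (\<integral>t. of_real (poly f t) + z * (of_real (poly f t) * (1 / (complex_of_real t - z))) \<partial>M)"
      by (simp only: weyl_def)
    also have "\<dots> = (\<integral>t. complex_of_real (poly f t) \<partial>M) +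
        (\<integral>t. z * (of_real (poly f t) * (1 / (complex_of_real t - z))) \<partial>M)"
      using int ints by (intro Bochner_Integration.integral_add integrable_mult_right) auto
    finally show ?thesis
      by (simp only: integral_mult_right_zero integral_complex_of_real weyl_def)
  qed
  have mean: "(\<integral>t. poly (p n) t \<partial>M) = (if n = 0 then 1 else 0)" for n
    using orthonormal_integral[OF on, of 0 n] p0 by (simp split: if_splits)
  show "three_term a b z (\<lambda>n. weyl (p n) z)"
    unfolding three_term_def
  proof (intro allI impI)
    fix n :: nat
    assume n: "n \<ge> 1"
    then have "weyl ([:0, 1:] * p n) z =
        weyl (smult (a (n + 1)) (p (n + 1)) + smult (b (n + 1)) (p n) + smult (a n) (p (n - 1))) z"
      using rec unfolding jacobi_recursion_def by metis
    then show "z * weyl (p n) z = of_real (a (n + 1)) * weyl (p (n + 1)) z +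
        of_real (b (n + 1)) * weyl (p n) z + of_real (a n) * weyl (p (n - 1)) z"
      using n unfolding shift add smult mean by simp
  qed
  show w0: "weyl (p 0) z = stieltjes M z"
    by (simp add: weyl_def stieltjes_def p0)
  have "weyl ([:0, 1:] * p 0) z = weyl (smult (a 1) (p 1) + smult (b 1) (p 0)) z"
    using rec unfolding jacobi_recursion_def by metis
  then show "of_real (a 1) * weyl (p 1) z = 1 + (z - of_real (b 1)) * stieltjes M z"
    unfolding shift add smult mean w0 by (simp add: algebra_simps)
qed

lemma weyl_eq:
  assumes on: "orthonormal_polys M p"
    and rec: "jacobi_recursion p a b" and p0: "p 0 = 1" and a: "\<forall>n\<ge>1. a n > 0"
    and z: "Im z \<noteq> 0"
  shows "weyl (p n) z = second_kind a b z n + stieltjes M z * cpoly (p n) z"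
proof -
  note w = weyl_three_term[OF on rec p0 z]
  have a1: "a 1 \<noteq> 0"
    using a by force
  have "of_real (a 1) * weyl (p 1) z =
      of_real (a 1) * (second_kind a b z 1 + stieltjes M z * cpoly (p 1) z)"
    using w(3) cpoly_jacobi_one[OF rec p0, of z] a1 by (simp add: distrib_left mult.left_commute)
  then have "weyl (p n) z = 1 * second_kind a b z n + stieltjes M z * cpoly (p n) z"
    using a1 w(2) p0
    by - (rule three_term_unique[OF w(1) three_term_linear[OF three_term_second_kind[OF a]
        three_term_cpoly[OF rec]] a], simp_all)
  then show ?thesis
    by simp
qed

end

text \<open>
  The Weyl solutions of \<open>\<mu>\<close> and of its rank one perturbation solve the same recursion away from
  \<open>0\<close> and tend to \<open>0\<close>, so that their constant Wronskian vanishes. This is the Aronszajn-Krein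
  formula, with the division cleared.
\<close>

lemma stieltjes_perturbation:
  assumes M: "real_distribution M" "orthonormal_polys M p"
      "jacobi_recursion p a b"
    and N: "real_distribution N" "orthonormal_polys N q"
      "jacobi_recursion q a (\<lambda>n. b n + \<beta> * (if n = 1 then 1 else 0))"
    and a: "\<forall>n\<ge>1. a n > 0" "bounded (a ` {1..})" and z: "Im z > 0"
  shows "stieltjes N z * (1 + of_real \<beta> * stieltjes M z) = stieltjes M z"
proof -
  let ?b = "\<lambda>n. b n + \<beta> * (if n = 1 then 1 else 0)"
  have z': "Im z \<noteq> 0" using z by simp
  have p0: "p 0 = 1" and q0: "q 0 = 1"
    using M N by (auto intro: orthonormal_poly_zero simp: real_distribution_def)
  let ?u = "\<lambda>n. real_distribution.weyl M (p n) z" and ?v = "\<lambda>n. real_distribution.weyl N (q n) z"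
  note u = real_distribution.weyl_three_term[OF M p0 z'] and v = real_distribution.weyl_three_term[OF N q0 z']
  have v': "three_term a b z ?v"
    using v(1) by (simp add: three_term_def)
  have tendsto0: "f \<longlonglongrightarrow> 0" if "\<And>n. (\<Sum>j<n. (cmod (f j))\<^sup>2) \<le> C" for f :: "nat \<Rightarrow> complex" and C
  proof -
    have "summable (\<lambda>j. (cmod (f j))\<^sup>2)"
      using that by (intro summableI_nonneg_bounded) auto
    then have "(\<lambda>j. (cmod (f j))\<^sup>2) \<longlonglongrightarrow> 0"
      by (rule summable_LIMSEQ_zero)
    then have "(\<lambda>j. sqrt ((cmod (f j))\<^sup>2)) \<longlonglongrightarrow> sqrt 0"
      by (rule tendsto_real_sqrt)
    then show ?thesis
      by (simp add: tendsto_norm_zero_iff)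
  qed
  have lim: "?u \<longlonglongrightarrow> 0" "?v \<longlonglongrightarrow> 0"
    by (rule tendsto0[OF real_distribution.weyl_square_summable[OF M(1,2) z]],
        rule tendsto0[OF real_distribution.weyl_square_summable[OF N(1,2) z]])
  have const: "wronskian a n ?u ?v = wronskian a 1 ?u ?v" if "n \<ge> 1" for n
    using christoffel_darboux[OF u(1) v' that] by simp
  obtain C where C: "\<And>n. n \<ge> 1 \<Longrightarrow> \<bar>a n\<bar> \<le> C"
    using a(2) by (auto simp: bounded_iff)
  have "(\<lambda>n. wronskian a (Suc n) ?u ?v) \<longlonglongrightarrow> 0"
  proof (rule Lim_null_comparison)
    have "cmod (wronskian a (Suc n) ?u ?v) \<le> C * cmod (?u (Suc n) * ?v n - ?u n * ?v (Suc n))" for n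
    proof -
      have "\<bar>a (Suc n)\<bar> \<le> C"
        using C by simp
      from mult_right_mono[OF this norm_ge_zero] show ?thesis
        by (simp only: wronskian_def norm_mult norm_of_real diff_Suc_1)
    qed
    then show "\<forall>\<^sub>F n in sequentially. cmod (wronskian a (Suc n) ?u ?v) \<le>
        C * cmod (?u (Suc n) * ?v n - ?u n * ?v (Suc n))"
      by simp
    have "(\<lambda>n. ?u (Suc n) * ?v n - ?u n * ?v (Suc n)) \<longlonglongrightarrow> 0 * 0 - 0 * 0"
      by (rule tendsto_diff[OF tendsto_mult[OF LIMSEQ_Suc[OF lim(1)] lim(2)]
            tendsto_mult[OF lim(1) LIMSEQ_Suc[OF lim(2)]]])
    then show "(\<lambda>n. C * cmod (?u (Suc n) * ?v n - ?u n * ?v (Suc n))) \<longlonglongrightarrow> 0"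
      by (intro tendsto_mult_right_zero tendsto_norm_zero) (simp only: mult_zero_left diff_self)
  qed
  moreover have "(\<lambda>n. wronskian a (Suc n) ?u ?v) = (\<lambda>n. wronskian a 1 ?u ?v)"
    by (rule ext, rule const) simp
  ultimately have "(\<lambda>n. wronskian a 1 ?u ?v) \<longlonglongrightarrow> 0"
    by (simp only:)
  then have "wronskian a 1 ?u ?v = 0"
    by (simp add: LIMSEQ_const_iff)
  moreover have "wronskian a 1 ?u ?v = of_real (a 1) * ?u 1 * ?v 0 - ?u 0 * (of_real (a 1) * ?v 1)"
    by (simp add: wronskian_def algebra_simps)
  ultimately have "(1 + (z - of_real (b 1)) * stieltjes M z) * stieltjes N z =
      stieltjes M z * (1 + (z - of_real (?b 1)) * stieltjes N z)"
    unfolding u(2,3) v(2,3) by simp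
  then show ?thesis
    by (simp add: algebra_simps)
qed

section \<open>Normal families and a Liouville theorem\<close>

text \<open>
  By Montel's theorem a locally bounded sequence of holomorphic functions converges as soon as
  its subsequential limits coincide.
\<close>

lemma uniform_limit_by_normality:
  fixes f :: "nat \<Rightarrow> complex \<Rightarrow> complex"
  assumes S: "open S" and hol: "\<And>n. f n holomorphic_on S"
    and bdd: "\<And>K. compact K \<Longrightarrow> K \<subseteq> S \<Longrightarrow> \<exists>B. \<forall>\<^sub>F n in sequentially. \<forall>z\<in>K. cmod (f n z) \<le> B"
    and uniq: "\<And>r h z. strict_mono (r :: nat \<Rightarrow> nat) \<Longrightarrow> h holomorphic_on S \<Longrightarrow>
       (\<And>z. z \<in> S \<Longrightarrow> (\<lambda>n. f (r n) z) \<longlonglongrightarrow> h z) \<Longrightarrow> z \<in> S \<Longrightarrow> h z = g z"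
    and K: "compact K" "K \<subseteq> S"
  shows "uniform_limit K f g sequentially"
proof (rule ccontr)
  assume "\<not> ?thesis"
  then obtain e where e: "e > 0" and freq: "\<not> (\<forall>\<^sub>F n in sequentially. \<forall>z\<in>K. dist (f n z) (g z) < e)"
    unfolding uniform_limit_iff by blast
  define X where "X = {n. \<exists>z\<in>K. dist (f n z) (g z) \<ge> e}"
  have "infinite X"
  proof
    assume "finite X"
    then obtain N where "\<forall>n\<in>X. n < N"
      using finite_nat_set_iff_bounded by blast
    then have "\<forall>n\<ge>N. n \<notin> X"
      by (meson linorder_not_le)
    then have "\<forall>n\<ge>N. \<forall>z\<in>K. dist (f n z) (g z) < e"
      by (simp add: X_def not_le)
    with freq show False
      unfolding eventually_sequentially by blast
  qed
  then obtain r :: "nat \<Rightarrow> nat" where r: "strict_mono r" "\<And>n. r n \<in> X"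
    using infinite_enumerate[OF \<open>infinite X\<close>] by blast
  have bdd_all: "\<exists>B. \<forall>h\<in>range (\<lambda>n. f (r n)). \<forall>z\<in>L. cmod (h z) \<le> B"
    if L: "compact L" "L \<subseteq> S" for L
  proof -
    obtain B N where B: "\<And>n z. n \<ge> N \<Longrightarrow> z \<in> L \<Longrightarrow> cmod (f n z) \<le> B"
      using bdd[OF L] unfolding eventually_sequentially by blast
    have "\<exists>C. \<forall>z\<in>L. cmod (f n z) \<le> C" for n
    proof -
      have "compact (f n ` L)"
        using L hol by (intro compact_continuous_image holomorphic_on_imp_continuous_on)
          (auto intro: holomorphic_on_subset)
      then show ?thesis
        using compact_imp_bounded bounded_iff by (metis imageI)
    qed
    then obtain C where C: "\<And>n z. z \<in> L \<Longrightarrow> cmod (f n z) \<le> C n"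
      by metis
    have "cmod (f n z) \<le> Max (insert B (C ` {..<N}))" if "z \<in> L" for n z
    proof (cases "n < N")
      case True
      then have "C n \<le> Max (insert B (C ` {..<N}))"
        by (intro Max_ge) auto
      then show ?thesis using C[OF that, of n] by linarith
    next
      case False
      then have "cmod (f n z) \<le> B"
        using B that by simp
      also have "B \<le> Max (insert B (C ` {..<N}))"
        by (intro Max_ge) auto
      finally show ?thesis .
    qed
    then show ?thesis
      by blast
  qed
  obtain h s where h: "h holomorphic_on S" and s: "strict_mono (s :: nat \<Rightarrow> nat)"
    and lim: "\<And>z. z \<in> S \<Longrightarrow> (\<lambda>n. f (r (s n)) z) \<longlonglongrightarrow> h z"
    and unif: "\<And>L. compact L \<Longrightarrow> L \<subseteq> S \<Longrightarrow> uniform_limit L ((\<lambda>n. f (r n)) \<circ> s) h sequentially"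
    using Montel[OF S, of "range (\<lambda>n. f (r n))" "\<lambda>n. f (r n)"] hol bdd_all by blast
  have "h z = g z" if "z \<in> K" for z
    using uniq[of "r \<circ> s" h z] strict_mono_o[OF r(1) s] h lim that K by auto
  then have "\<forall>\<^sub>F n in sequentially. \<forall>z\<in>K. dist (f (r (s n)) z) (g z) < e"
    using unif[OF K] e unfolding uniform_limit_iff by simp
  then obtain n where "\<forall>z\<in>K. dist (f (r (s n)) z) (g z) < e"
    by (auto simp: eventually_sequentially)
  then show False
    using r(2)[of "s n"] unfolding X_def by fastforce
qed

text \<open>
  On the circle of radius \<open>R\<close> one has \<open>\<bar>z\<^sup>2 - R\<^sup>2\<bar> = 2 R \<bar>Im z\<bar>\<close>, so that the factor \<open>z\<^sup>2 - R\<^sup>2\<close>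
  absorbs a blow-up of order \<open>1 / \<bar>Im z\<bar>\<close> on the real axis.
\<close>

lemma bound_off_real_axis:
  fixes f :: "complex \<Rightarrow> complex"
  assumes hol: "f holomorphic_on UNIV" and R: "R > 0"
    and bnd: "\<And>z. cmod z = R \<Longrightarrow> Im z \<noteq> 0 \<Longrightarrow> \<bar>Im z\<bar> * cmod (f z) \<le> B" and "B \<ge> 0"
    and z: "cmod z \<le> R / 2"
  shows "cmod (f z) \<le> 8 * B / (3 * R)"
proof -
  let ?g = "\<lambda>z. (z\<^sup>2 - of_real (R\<^sup>2)) * f z"
  have "cmod (?g z) \<le> 2 * R * B"
  proof (rule maximum_modulus_frontier[of ?g "cball 0 R"])
    show "?g holomorphic_on interior (cball 0 R)"
      using hol by (intro holomorphic_intros) (auto intro: holomorphic_on_subset)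
    show "continuous_on (closure (cball 0 R)) ?g"
      using hol by (intro continuous_intros holomorphic_on_imp_continuous_on)
        (auto intro: holomorphic_on_subset)
    show "z \<in> cball 0 R"
      using z R by simp
    fix w :: complex
    assume "w \<in> frontier (cball 0 R)"
    then have w: "cmod w = R"
      using R by (simp add: dist_norm)
    then have "of_real (R\<^sup>2) = w * cnj w"
      using complex_norm_square[of w] by simp
    then have "w\<^sup>2 - of_real (R\<^sup>2) = w * (w - cnj w)"
      by (simp add: power2_eq_square algebra_simps)
    then have "cmod (w\<^sup>2 - of_real (R\<^sup>2)) = 2 * R * \<bar>Im w\<bar>"
      using w by (simp add: norm_mult complex_diff_cnj)
    then have "cmod (?g w) = 2 * R * (\<bar>Im w\<bar> * cmod (f w))"
      by (simp add: norm_mult)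
    also have "\<dots> \<le> 2 * R * B"
      using bnd[OF w] R \<open>B \<ge> 0\<close> by (cases "Im w = 0") auto
    finally show "cmod (?g w) \<le> 2 * R * B" .
  qed simp
  moreover have "3 / 4 * R\<^sup>2 \<le> cmod (z\<^sup>2 - of_real (R\<^sup>2))"
  proof -
    have "(cmod z)\<^sup>2 \<le> (R / 2)\<^sup>2"
      using z by (intro power_mono) auto
    moreover have "cmod (of_real (R\<^sup>2)) - cmod (z\<^sup>2) \<le> cmod (of_real (R\<^sup>2) - z\<^sup>2)"
      by (rule norm_triangle_ineq2)
    ultimately show ?thesis
      by (simp add: norm_power norm_minus_commute power_divide)
  qed
  ultimately have "3 / 4 * R\<^sup>2 * cmod (f z) \<le> 2 * R * B"
    using mult_right_mono[of _ _ "cmod (f z)"] by (fastforce simp: norm_mult)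
  then have "R * (3 * R * cmod (f z)) \<le> R * (8 * B)"
    by (simp add: power2_eq_square algebra_simps)
  then have "3 * R * cmod (f z) \<le> 8 * B"
    using R by (simp only: mult_le_cancel_left_pos)
  then show ?thesis
    using R by (simp add: field_simps)
qed

text \<open>
  The factor \<open>z\<^sup>2 - R\<^sup>2\<close> removes the blow-up on the real axis and leaves growth of order
  \<open>sqrt R\<close>, which is less than linear, so Cauchy's estimate makes the derivative vanish.
\<close>

lemma liouville_off_real_axis:
  fixes f :: "complex \<Rightarrow> complex"
  assumes hol: "f holomorphic_on UNIV" and c: "c \<ge> 0" "d \<ge> 0"
    and bnd: "\<And>z. Im z \<noteq> 0 \<Longrightarrow> cmod (f z) \<le> c * (1 + (cmod z + d) / sqrt \<bar>Im z\<bar>)"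
  shows "f z = f w"
proof -
  have growth: "cmod (f z) \<le> 8 / 3 * c * (1 + (R + d) / sqrt R)" if "R > 0" "cmod z \<le> R / 2" for z R
  proof -
    have "cmod (f z) \<le> 8 * (c * (R + (R + d) * sqrt R)) / (3 * R)"
    proof (rule bound_off_real_axis[OF hol \<open>R > 0\<close>])
      fix z
      assume z: "cmod z = R" "Im z \<noteq> 0"
      define y where "y = \<bar>Im z\<bar>"
      have y: "y > 0" "y \<le> R"
        using z abs_Im_le_cmod[of z] by (auto simp: y_def)
      have "y * cmod (f z) \<le> y * (c * (1 + (R + d) / sqrt y))"
        using bnd[OF z(2)] z y by (simp add: y_def mult_left_mono)
      also have "\<dots> = c * (y + (R + d) * sqrt y)"
        using y by (simp add: field_simps)
      also have "\<dots> \<le> c * (R + (R + d) * sqrt R)"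
        using y c that by (intro mult_left_mono add_mono) auto
      finally show "\<bar>Im z\<bar> * cmod (f z) \<le> c * (R + (R + d) * sqrt R)"
        by (simp add: y_def)
    qed (use c that in auto)
    also have "\<dots> = 8 / 3 * c * (1 + (R + d) / sqrt R)"
    proof -
      define s where "s = sqrt R"
      have "s > 0" "R = s * s"
        using that by (auto simp: s_def)
      then show ?thesis
        unfolding s_def[symmetric] by (simp add: field_simps)
    qed
    finally show ?thesis .
  qed
  have "deriv f x = 0" for x
  proof -
    have le: "cmod (deriv f x) \<le> 8 / 3 * c * (1 + (4 * r + d) / sqrt (4 * r)) / r" if r: "r > cmod x" "r > 0" for r
    proof -
      have "cmod ((deriv ^^ 1) f x) \<le> fact 1 * (8 / 3 * c * (1 + (4 * r + d) / sqrt (4 * r))) / r ^ 1"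
      proof (rule Cauchy_inequality)
        show "f holomorphic_on ball x r" "continuous_on (cball x r) f"
          using hol by (auto intro: holomorphic_on_subset holomorphic_on_imp_continuous_on)
        fix y
        assume "cmod (x - y) = r"
        then have "cmod y \<le> 4 * r / 2"
          using norm_triangle_sub[of y x] r by (simp add: norm_minus_commute)
        then show "cmod (f y) \<le> 8 / 3 * c * (1 + (4 * r + d) / sqrt (4 * r))"
          using growth r by simp
      qed (use r in auto)
      then show ?thesis by simp
    qed
    have "((\<lambda>r. 8 / 3 * c * (1 + (4 * r + d) / sqrt (4 * r)) / r) \<longlongrightarrow> 0) at_top"
      by real_asymp
    moreover have "\<forall>\<^sub>F r in at_top. cmod (deriv f x) \<le> 8 / 3 * c * (1 + (4 * r + d) / sqrt (4 * r)) / r"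
      using eventually_gt_at_top[of "cmod x"] eventually_gt_at_top[of 0] by eventually_elim (rule le)
    ultimately have "cmod (deriv f x) \<le> 0"
      by (intro tendsto_lowerbound) auto
    then show ?thesis by simp
  qed
  moreover have "(f has_field_derivative deriv f x) (at x within UNIV)" for x
    by (rule holomorphic_derivI[OF hol open_UNIV UNIV_I])
  ultimately have "(f has_field_derivative 0) (at x within UNIV)" for x
    by (simp only:)
  then obtain k where "\<And>x. f x = k"
    using has_field_derivative_zero_constant[OF convex_UNIV, of f] by (metis UNIV_I)
  then show ?thesis
    by simp
qed

section \<open>Auxiliary facts on the sine kernel and uniform limits\<close>

lemma holomorphic_sin_quotient: "sin_quotient c holomorphic_on UNIV"
proof -
  have "deriv (\<lambda>z. sin (c * z)) 0 = c"
    by (rule DERIV_imp_deriv) (auto intro!: derivative_eq_intros)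
  then have "sin_quotient c =
      (\<lambda>z. if z = 0 then deriv (\<lambda>z. sin (c * z)) 0 else (sin (c * z) - sin (c * 0)) / (z - 0))"
    by (auto simp: sin_quotient_def fun_eq_iff)
  moreover have "(\<lambda>z. sin (c * z)) holomorphic_on UNIV"
    by (intro holomorphic_intros)
  ultimately show ?thesis
    using pole_lemma[of "\<lambda>z. sin (c * z)" UNIV 0] by simp
qed

lemma sin_quotient_mult: "(x - y) * sin_quotient c (y - x) = sin (c * (x - y))"
proof (cases "x = y")
  case False
  then have "y - x \<noteq> 0"
    by simp
  then have "(x - y) * (sin (c * (y - x)) / (y - x)) = - sin (c * (y - x))"
    by (simp add: field_simps)
  then have "(x - y) * sin_quotient c (y - x) = - sin (c * (y - x))"
    using False by (simp add: sin_quotient_def)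
  also have "\<dots> = sin (c * (x - y))"
    by (simp add: sin_minus[symmetric] algebra_simps del: sin_minus)
  finally show ?thesis .
qed (simp add: sin_quotient_def)

lemma uniform_limit_fst:
  "uniform_limit A f g F \<Longrightarrow> uniform_limit (A \<times> B) (\<lambda>n (x, y). f n x) (\<lambda>(x, y). g x) F"
  unfolding uniform_limit_iff by (auto elim!: eventually_mono)

lemma uniform_limit_snd:
  "uniform_limit B f g F \<Longrightarrow> uniform_limit (A \<times> B) (\<lambda>n (x, y). f n y) (\<lambda>(x, y). g y) F"
  unfolding uniform_limit_iff by (auto elim!: eventually_mono)

lemma uniform_limit_const_seq:
  "(f \<longlongrightarrow> l) F \<Longrightarrow> uniform_limit X (\<lambda>n _. f n) (\<lambda>_. l) F"
  unfolding uniform_limit_iff tendsto_iff by (auto elim!: eventually_mono)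

lemma bounded_image_continuous:
  "compact K \<Longrightarrow> continuous_on K f \<Longrightarrow> bounded (f ` K)"
  by (intro compact_imp_bounded compact_continuous_image)

text \<open>
  Near the diagonal, the maximum principle in \<open>y\<close> on the disc of radius \<open>1\<close> about \<open>x\<close> moves the
  estimate to the circle \<open>\<bar>x - y\<bar> = 1\<close>, where the factor \<open>x - y\<close> is harmless.
\<close>

lemma uniform_limit_divide_diagonal:
  fixes k :: "nat \<Rightarrow> complex \<Rightarrow> complex \<Rightarrow> complex"
  assumes lim: "\<And>A B. compact A \<Longrightarrow> compact B \<Longrightarrow>
      uniform_limit (A \<times> B) (\<lambda>n (x, y). (x - y) * k n x y) (\<lambda>(x, y). (x - y) * l x y) sequentially"
    and hol: "\<And>n x. k n x holomorphic_on UNIV" "\<And>x. l x holomorphic_on UNIV"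
    and A: "compact A" and B: "compact B"
  shows "uniform_limit (A \<times> B) (\<lambda>n (x, y). k n x y) (\<lambda>(x, y). l x y) sequentially"
proof (rule uniform_limitI)
  fix e :: real
  assume e: "e > 0"
  \<comment> \<open>enlarged so as to contain the unit discs about the points of \<open>A\<close>\<close>
  define B' where "B' = B \<union> {x + u |x u. x \<in> A \<and> u \<in> cball 0 1}"
  have "compact B'"
    unfolding B'_def by (intro compact_Un B compact_sums A compact_cball)
  from uniform_limitD[OF lim[OF A this], of "e / 2"] e
  have "\<forall>\<^sub>F n in sequentially. \<forall>x\<in>A. \<forall>y\<in>B'. cmod ((x - y) * (k n x y - l x y)) < e / 2"
    by (auto elim!: eventually_mono simp: dist_norm right_diff_distrib)
  then show "\<forall>\<^sub>F n in sequentially. \<forall>z\<in>A \<times> B.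
      dist (case z of (x, y) \<Rightarrow> k n x y) (case z of (x, y) \<Rightarrow> l x y) < e"
  proof eventually_elim
    case (elim n)
    have "cmod (k n x y - l x y) < e" if x: "x \<in> A" and y: "y \<in> B" for x y
    proof (cases "cmod (x - y) \<ge> 1")
      case True
      have "cmod (k n x y - l x y) \<le> cmod (x - y) * cmod (k n x y - l x y)"
        using True mult_right_mono[of 1 "cmod (x - y)" "cmod (k n x y - l x y)"] by simp
      also have "\<dots> < e / 2"
        using elim x y by (auto simp: norm_mult B'_def)
      finally show ?thesis
        using e by simp
    next
      case False
      have "cmod (k n x y - l x y) \<le> e / 2"
      proof (rule maximum_modulus_frontier[of "\<lambda>y. k n x y - l x y" "cball x 1"])
        show "(\<lambda>y. k n x y - l x y) holomorphic_on interior (cball x 1)"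
          using hol by (intro holomorphic_intros) (auto intro: holomorphic_on_subset)
        show "continuous_on (closure (cball x 1)) (\<lambda>y. k n x y - l x y)"
          using hol by (intro continuous_intros holomorphic_on_imp_continuous_on)
            (auto intro: holomorphic_on_subset)
        show "y \<in> cball x 1"
          using False by (simp add: dist_norm)
        fix z
        assume "z \<in> frontier (cball x 1)"
        then have z: "cmod (x - z) = 1"
          by (simp add: dist_norm)
        have "z = x + (z - x)" "z - x \<in> cball 0 1"
          using z by (auto simp: norm_minus_commute)
        then have "z \<in> B'"
          unfolding B'_def using x by blast
        then show "cmod (k n x z - l x z) \<le> e / 2"
          using elim x z by (fastforce simp: norm_mult)
      qed simp
      then show ?thesis
        using e by simp
    qed
    then show ?case
      by (auto simp: dist_norm)
  qed
qed

section \<open>Scaling limits at a point of bulk universality\<close>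

text \<open>
  The setting of the scaling limit at \<open>x0\<close>. All functions below take scaled variables:
  \<open>pt n x\<close> is the point \<open>x0 + x / n\<close>, \<open>S n\<close> is the Wronskian of \<open>p\<close> with itself, hence
  \<open>(x - y) K\<^sub>n / n\<close>, and \<open>Q n\<close> the Wronskian of the second solution with \<open>p\<close>. The assumed
  universality says that \<open>S n x y\<close> tends to \<open>\<sigma> sin (\<theta> x y)\<close>.
\<close>

locale bulk_scaling = real_distribution M for M +
  fixes p :: "nat \<Rightarrow> real poly" and a b :: "nat \<Rightarrow> real" and x0 \<rho> w0 :: real and L :: complex
  assumes orthonormal: "orthonormal_polys M p"
    and recursion: "jacobi_recursion p a b"
    and a_pos: "\<forall>n\<ge>1. a n > 0"
    and rho_pos: "\<rho> > 0" and w0_pos: "w0 > 0"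
    and boundary_value: "((\<lambda>\<epsilon>. stieltjes M (Complex x0 \<epsilon>)) \<longlongrightarrow> L) (at_right 0)"
    and universality: "sine_kernel_asymptotics p x0 \<rho> w0"
begin

lemma p_zero: "p 0 = 1"
  using orthonormal_poly_zero[OF prob_space_axioms orthonormal] .

definition pt :: "nat \<Rightarrow> complex \<Rightarrow> complex" where
  "pt n x = of_real x0 + x / of_nat n"

definition S :: "nat \<Rightarrow> complex \<Rightarrow> complex \<Rightarrow> complex" where
  "S n x y = wronskian a n (\<lambda>j. cpoly (p j) (pt n x)) (\<lambda>j. cpoly (p j) (pt n y))"

definition Q :: "nat \<Rightarrow> complex \<Rightarrow> complex \<Rightarrow> complex" where
  "Q n x y = wronskian a n (second_kind a b (pt n x)) (\<lambda>j. cpoly (p j) (pt n y))"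

definition F :: "nat \<Rightarrow> complex \<Rightarrow> complex" where
  "F n x = stieltjes M (pt n x)"

definition \<sigma> :: real where "\<sigma> = 1 / (pi * w0)"

definition \<theta> :: "complex \<Rightarrow> complex \<Rightarrow> complex" where
  "\<theta> x y = of_real (pi * \<rho>) * (x - y)"

lemma sigma_pos: "\<sigma> > 0"
  using w0_pos by (simp add: \<sigma>_def)

lemma holomorphic_pt [holomorphic_intros]: "pt n holomorphic_on A"
  unfolding pt_def divide_inverse by (intro holomorphic_intros)

lemma Im_pt: "Im (pt n x) = Im x / n"
  by (simp add: pt_def)

lemma pt_diff: "pt n x - pt n y = (x - y) / of_nat n"
  by (simp add: pt_def diff_divide_distrib)

lemma pt_cnj: "pt n (cnj x) = cnj (pt n x)"
  by (simp add: pt_def)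

lemma S_eq: "n \<ge> 1 \<Longrightarrow> S n x y = (x - y) * (cd_kernel p n (pt n x) (pt n y) / of_nat n)"
  unfolding S_def wronskian_pp[OF recursion p_zero] by (simp add: pt_diff)

lemma kernel_tendsto:
  "(\<lambda>n. cd_kernel p n (pt n x) (pt n y) / of_nat n) \<longlonglongrightarrow>
     sin_quotient (of_real (pi * \<rho>)) (y - x) / of_real (pi * w0)"
proof -
  have "uniform_limit ({x} \<times> {y})
      (\<lambda>n (a, b). cd_kernel p n (of_real x0 + a / of_nat n) (of_real x0 + b / of_nat n) / of_nat n)
      (\<lambda>(a, b). sin_quotient (of_real (pi * \<rho>)) (b - a) / of_real (pi * w0)) sequentially"
    by (rule universality[unfolded sine_kernel_asymptotics_def, rule_format]) simp_all
  from tendsto_uniform_limitI[OF this, of "(x, y)"]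
  have "(\<lambda>n. cd_kernel p n (of_real x0 + x / of_nat n) (of_real x0 + y / of_nat n) / of_nat n) \<longlonglongrightarrow>
      sin_quotient (of_real (pi * \<rho>)) (y - x) / of_real (pi * w0)"
    unfolding prod.case mem_Sigma_iff singleton_iff by (simp only:)
  then show ?thesis
    by (simp only: pt_def)
qed

lemma S_uniform_limit:
  assumes A: "compact A" and B: "compact B"
  shows "uniform_limit (A \<times> B) (\<lambda>n (x, y). S n x y) (\<lambda>(x, y). of_real \<sigma> * sin (\<theta> x y)) sequentially"
proof -
  let ?k = "\<lambda>n (a, b). cd_kernel p n (of_real x0 + a / of_nat n) (of_real x0 + b / of_nat n) / of_nat n"
  let ?l = "\<lambda>(a, b). sin_quotient (of_real (pi * \<rho>)) (b - a) / of_real (pi * w0)"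
  have comp: "compact (A \<times> B)"
    using A B by (rule compact_Times)
  have "continuous_on (A \<times> B) (\<lambda>z. sin_quotient (of_real (pi * \<rho>)) (snd z - fst z))"
    by (rule continuous_on_compose2[OF holomorphic_on_imp_continuous_on[OF holomorphic_sin_quotient]])
       (auto intro!: continuous_intros)
  then have cont: "continuous_on (A \<times> B) ?l"
    unfolding case_prod_unfold using w0_pos by (intro continuous_intros) auto
  have ul: "uniform_limit (A \<times> B) (\<lambda>n z. (fst z - snd z) * ?k n z) (\<lambda>z. (fst z - snd z) * ?l z) sequentially"
  proof (rule uniform_lim_mult)
    show "uniform_limit (A \<times> B) ?k ?l sequentially"
      by (rule universality[unfolded sine_kernel_asymptotics_def, rule_format, OF A B])
    show "uniform_limit (A \<times> B) (\<lambda>n z. fst z - snd z) (\<lambda>z. fst z - snd z) sequentially"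
      by (rule uniform_limit_const)
    show "bounded (?l ` (A \<times> B))"
      using comp cont by (rule bounded_image_continuous)
    show "bounded ((\<lambda>z. fst z - snd z) ` (A \<times> B))"
      using comp by (rule bounded_image_continuous) (intro continuous_intros)
  qed
  have leq: "(fst z - snd z) * ?l z = (case z of (x, y) \<Rightarrow> of_real \<sigma> * sin (\<theta> x y))" for z
    by (simp add: \<sigma>_def \<theta>_def sin_quotient_mult[symmetric] split_beta)
  have feq: "\<forall>\<^sub>F n in sequentially. \<forall>z\<in>A \<times> B. (fst z - snd z) * ?k n z = (case z of (x, y) \<Rightarrow> S n x y)"
    using eventually_ge_at_top[of 1] by eventually_elim (auto simp: S_eq pt_def)
  show ?thesis
    by (rule iffD1[OF uniform_limit_cong[OF feq leq] ul])
qed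

lemma S_tendsto: "(\<lambda>n. S n x y) \<longlonglongrightarrow> of_real \<sigma> * sin (\<theta> x y)"
  using tendsto_uniform_limitI[OF S_uniform_limit[of "{x}" "{y}"], of "(x, y)"] by simp

lemma F_harnack:
  assumes "n \<ge> 1" "Im z > 0" "Im z' > 0"
  shows "cmod (F n z - F n z') \<le>
     cmod (z - z') * ((1 + cmod (z - z') / Im z) * (Im (F n z') / Im z'))"
  using stieltjes_harnack[of "pt n z" "pt n z'"] assms
  by (simp add: F_def Im_pt pt_diff norm_divide)

lemma F_vertical_tendsto:
  assumes "y > 0"
  shows "(\<lambda>n. F n (Complex 0 y)) \<longlonglongrightarrow> L"
proof -
  have "filterlim (\<lambda>n::nat. y / n) (at_right 0) sequentially"
    using assms by real_asymp
  from filterlim_compose[OF boundary_value this] have "(\<lambda>n::nat. stieltjes M (Complex x0 (y / n))) \<longlonglongrightarrow> L" .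
  moreover have "Complex x0 (y / n) = pt n (Complex 0 y)" for n :: nat
    by (simp add: pt_def complex_eq_iff)
  ultimately show ?thesis
    by (simp add: F_def)
qed

lemma Im_L_nonneg: "0 \<le> Im L"
proof (rule tendsto_lowerbound)
  show "(\<lambda>n. Im (F n (Complex 0 1))) \<longlonglongrightarrow> Im L"
    using F_vertical_tendsto[of 1] by (intro tendsto_intros) simp
  show "\<forall>\<^sub>F n in sequentially. 0 \<le> Im (F n (Complex 0 1))"
    using eventually_ge_at_top[of 1]
    by eventually_elim (simp add: F_def Im_pt Im_stieltjes_nonneg)
qed simp

text \<open>
  The boundary value is assumed along the vertical line only. The rescaled transforms form a
  normal family on the upper half plane by the Harnack bound, and a limit of them that is
  constant on the imaginary half axis is constant.
\<close>

lemma F_tendsto: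
  assumes "Im z > 0"
  shows "(\<lambda>n. F n z) \<longlonglongrightarrow> L"
proof -
  let ?H = "{z. Im z > 0}"
  have "uniform_limit {z} (\<lambda>n. F (Suc n)) (\<lambda>_. L) sequentially"
  proof (rule uniform_limit_by_normality[of ?H])
    show "open ?H" by (rule open_halfspace_Im_gt)
    fix n
    have "stieltjes M \<circ> pt (Suc n) holomorphic_on ?H"
      by (intro holomorphic_on_compose_gen[OF _ stieltjes_holomorphic] holomorphic_intros)
         (auto simp: Im_pt)
    then show "F (Suc n) holomorphic_on ?H"
      by (simp add: F_def o_def cong: holomorphic_cong)
  next
    fix K
    assume K: "compact K" "K \<subseteq> ?H"
    define g where "g z = cmod (z - \<i>) * (1 + cmod (z - \<i>) / Im z)" for z
    have "continuous_on K g"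
      unfolding g_def using K(2) by (intro continuous_intros) auto
    then have "bounded (g ` K)"
      using K(1) by (intro bounded_image_continuous)
    then obtain C where C: "\<And>z. z \<in> K \<Longrightarrow> \<bar>g z\<bar> \<le> C"
      by (auto simp: bounded_iff)
    have "(\<lambda>n. cmod (F (Suc n) \<i>)) \<longlonglongrightarrow> cmod L"
      using LIMSEQ_Suc[OF F_vertical_tendsto[of 1]] by (intro tendsto_intros) (simp add: imaginary_unit.code)
    then have "\<forall>\<^sub>F n in sequentially. cmod (F (Suc n) \<i>) < cmod L + 1"
      by (rule order_tendstoD) simp
    then have "\<forall>\<^sub>F n in sequentially. \<forall>z\<in>K. cmod (F (Suc n) z) \<le> (C + 1) * (cmod L + 1)"
    proof eventually_elim
      case (elim n)
      show ?case
      proof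
        fix z
        assume z: "z \<in> K"
        have "cmod (F (Suc n) z - F (Suc n) \<i>) \<le> g z * Im (F (Suc n) \<i>)"
          using F_harnack[of "Suc n" z \<i>] K z by (auto simp: g_def mult.assoc)
        also have "\<dots> \<le> C * (cmod L + 1)"
        proof (rule mult_mono)
          show "g z \<le> C" "0 \<le> C" using C[OF z] by auto
          show "Im (F (Suc n) \<i>) \<le> cmod L + 1"
            using elim abs_Im_le_cmod[of "F (Suc n) \<i>"] by linarith
          show "0 \<le> Im (F (Suc n) \<i>)"
            by (simp add: F_def Im_pt Im_stieltjes_nonneg)
        qed
        finally show "cmod (F (Suc n) z) \<le> (C + 1) * (cmod L + 1)"
          using norm_triangle_sub[of "F (Suc n) z" "F (Suc n) \<i>"] elim by (simp add: algebra_simps)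
      qed
    qed
    then show "\<exists>B. \<forall>\<^sub>F n in sequentially. \<forall>z\<in>K. cmod (F (Suc n) z) \<le> B" ..
  next
    fix r :: "nat \<Rightarrow> nat" and h z
    assume r: "strict_mono r" and h: "h holomorphic_on ?H"
      and lim: "\<And>z. z \<in> ?H \<Longrightarrow> (\<lambda>n. F (Suc (r n)) z) \<longlonglongrightarrow> h z" and z: "z \<in> ?H"
    have vert: "h (Complex 0 y) = L" if "y > 0" for y
    proof -
      have "(\<lambda>n. F (Suc (r n)) (Complex 0 y)) \<longlonglongrightarrow> L"
        using LIMSEQ_subseq_LIMSEQ[OF LIMSEQ_Suc[OF F_vertical_tendsto[OF that]] r] by (simp add: o_def)
      then show ?thesis
        using lim[of "Complex 0 y"] that LIMSEQ_unique by fastforce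
    qed
    have "(\<lambda>z. h z - L) z = 0"
    proof (rule analytic_continuation[of "\<lambda>z. h z - L" ?H "Complex 0 ` {0<..}" \<i>])
      show "(\<lambda>z. h z - L) holomorphic_on ?H"
        using h by (intro holomorphic_intros)
      show "open ?H" by (rule open_halfspace_Im_gt)
      show "connected ?H" by (intro convex_connected convex_halfspace_Im_gt)
      show "\<i> islimpt Complex 0 ` {0<..}"
        unfolding islimpt_sequential
      proof (intro exI conjI allI)
        let ?f = "\<lambda>n. Complex 0 (1 + 1 / real (Suc n))"
        show "?f n \<in> Complex 0 ` {0<..} - {\<i>}" for n
          by (auto simp: complex_eq_iff intro!: imageI add_pos_nonneg)
        have "(\<lambda>n. Complex 0 (1 + 1 / real (Suc n))) \<longlonglongrightarrow> Complex 0 (1 + 0)"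
          by (intro tendsto_Complex tendsto_intros LIMSEQ_Suc[OF lim_1_over_n])
        then show "?f \<longlonglongrightarrow> \<i>"
          by (simp add: imaginary_unit.code)
      qed
    qed (use vert z in auto)
    then show "h z = L" by simp
  qed (use assms in auto)
  then have "(\<lambda>n. F (Suc n) z) \<longlonglongrightarrow> L"
    by (rule tendsto_uniform_limitI) simp
  then show ?thesis
    by (rule LIMSEQ_imp_Suc)
qed

definition \<kappa> :: "nat \<Rightarrow> real \<Rightarrow> real" where
  "\<kappa> n y = Re (cd_kernel p n (pt n (of_real y)) (pt n (of_real y)) / of_nat n)"

lemma kappa_tendsto: "(\<lambda>n. \<kappa> n y) \<longlonglongrightarrow> \<rho> / w0"
proof -
  have "(\<lambda>n. \<kappa> n y) \<longlonglongrightarrow>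
      Re (sin_quotient (of_real (pi * \<rho>)) (of_real y - of_real y) / of_real (pi * w0))"
    unfolding \<kappa>_def by (intro tendsto_Re kernel_tendsto)
  also have "Re (sin_quotient (of_real (pi * \<rho>)) (of_real y - of_real y) / of_real (pi * w0)) = \<rho> / w0"
    by (simp add: sin_quotient_def flip: of_real_mult of_real_divide)
  finally show ?thesis .
qed

text \<open>
  \<open>Q + F S\<close> is the Wronskian of the Weyl solution at \<open>x\<close> with \<open>p\<close> at \<open>y\<close>, which by the
  Christoffel-Darboux summation is \<open>1\<close> plus a bilinear sum. The Cauchy-Schwarz inequality bounds
  that sum by the \<open>l\<^sup>2\<close> norm of the Weyl solution and the diagonal kernel; the powers of
  \<open>n\<close> cancel.
\<close>

lemma Q_Weyl_bound:
  assumes n: "n \<ge> 1" and x: "Im x > 0"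
  shows "cmod (Q n x (of_real y) + F n x * S n x (of_real y)) \<le>
     1 + cmod (x - of_real y) * (sqrt (Im (F n x) / Im x) * sqrt (\<kappa> n y))"
proof -
  define X where "X = pt n x"
  define t where "t = x0 + y / n"
  have Y: "pt n (of_real y) = of_real t"
    by (simp add: pt_def t_def)
  have X: "Im X > 0"
    using n x by (simp add: X_def Im_pt)
  define \<psi> where "\<psi> j = weyl (p j) X" for j
  have \<psi>: "\<psi> j = second_kind a b X j + stieltjes M X * cpoly (p j) X" for j
    unfolding \<psi>_def by (rule weyl_eq[OF orthonormal recursion p_zero a_pos]) (use X in simp)
  have cd: "cd_kernel p n u v = (\<Sum>j<n. cpoly (p j) u * cpoly (p j) v)" for u v
    by (simp add: cd_kernel_def cpoly_def)
  have "Q n x (of_real y) + F n x * S n x (of_real y) =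
      1 + (X - of_real t) * (\<Sum>j<n. second_kind a b X j * cpoly (p j) (of_real t)) +
      stieltjes M X * ((X - of_real t) * (\<Sum>j<n. cpoly (p j) X * cpoly (p j) (of_real t)))"
    unfolding Q_def S_def F_def Y X_def[symmetric] wronskian_qp[OF recursion p_zero n a_pos]
      wronskian_pp[OF recursion p_zero n] cd ..
  also have "\<dots> = 1 + (X - of_real t) * (\<Sum>j<n. \<psi> j * of_real (poly (p j) t))"
    by (simp add: \<psi> algebra_simps sum.distrib sum_distrib_left)
  finally have eq: "Q n x (of_real y) + F n x * S n x (of_real y) =
      1 + (X - of_real t) * (\<Sum>j<n. \<psi> j * of_real (poly (p j) t))" .
  have "cmod (\<Sum>j<n. \<psi> j * of_real (poly (p j) t)) \<le> (\<Sum>j<n. \<bar>cmod (\<psi> j)\<bar> * \<bar>poly (p j) t\<bar>)"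
    by (rule order_trans[OF norm_sum]) (simp add: norm_mult)
  also have "\<dots> \<le> L2_set (\<lambda>j. cmod (\<psi> j)) {..<n} * L2_set (\<lambda>j. poly (p j) t) {..<n}"
    by (rule L2_set_mult_ineq)
  finally have cs: "cmod (\<Sum>j<n. \<psi> j * of_real (poly (p j) t)) \<le>
      L2_set (\<lambda>j. cmod (\<psi> j)) {..<n} * L2_set (\<lambda>j. poly (p j) t) {..<n}" .
  have L2\<psi>: "L2_set (\<lambda>j. cmod (\<psi> j)) {..<n} \<le> sqrt (n * (Im (F n x) / Im x))"
    using weyl_square_summable[OF orthonormal X, of n] n
    by (simp add: L2_set_def \<psi>_def F_def X_def Im_pt field_simps)
  have L2p: "L2_set (\<lambda>j. poly (p j) t) {..<n} = sqrt (n * \<kappa> n y)"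
  proof -
    have "of_nat n * (cd_kernel p n (pt n (of_real y)) (pt n (of_real y)) / of_nat n) =
        complex_of_real (\<Sum>j<n. (poly (p j) t)\<^sup>2)"
      using n by (simp add: cd Y power2_eq_square)
    then have "Re (of_nat n * (cd_kernel p n (pt n (of_real y)) (pt n (of_real y)) / of_nat n)) =
        (\<Sum>j<n. (poly (p j) t)\<^sup>2)"
      by (simp only: Re_complex_of_real)
    moreover have "Re (of_nat n * (cd_kernel p n (pt n (of_real y)) (pt n (of_real y)) / of_nat n)) =
        n * \<kappa> n y"
      unfolding \<kappa>_def by simp
    ultimately show ?thesis
      by (simp add: L2_set_def)
  qed
  note cs
  also have "L2_set (\<lambda>j. cmod (\<psi> j)) {..<n} * L2_set (\<lambda>j. poly (p j) t) {..<n} \<le>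
      sqrt (n * (Im (F n x) / Im x)) * sqrt (n * \<kappa> n y)"
    using mult_right_mono[OF L2\<psi> L2_set_nonneg[of "\<lambda>j. poly (p j) t" "{..<n}"]] unfolding L2p .
  also have "\<dots> = n * (sqrt (Im (F n x) / Im x) * sqrt (\<kappa> n y))"
  proof -
    have "sqrt n * u * (sqrt n * v) = n * (u * v)" for u v :: real
    proof -
      have "sqrt n * u * (sqrt n * v) = (sqrt n * sqrt n) * (u * v)"
        by (simp only: mult_ac)
      then show ?thesis by simp
    qed
    then show ?thesis
      unfolding real_sqrt_mult[of "real n"] .
  qed
  finally have "cmod (X - of_real t) * cmod (\<Sum>j<n. \<psi> j * of_real (poly (p j) t)) \<le>
      cmod (X - of_real t) * (n * (sqrt (Im (F n x) / Im x) * sqrt (\<kappa> n y)))"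
    by (intro mult_left_mono) auto
  moreover have "cmod (X - of_real t) = cmod (x - of_real y) / n"
    unfolding Y[symmetric] X_def pt_diff by (simp add: norm_divide)
  ultimately have "cmod (X - of_real t) * cmod (\<Sum>j<n. \<psi> j * of_real (poly (p j) t)) \<le>
      cmod (x - of_real y) * (sqrt (Im (F n x) / Im x) * sqrt (\<kappa> n y))"
    using n by simp
  then show ?thesis
    unfolding eq using norm_triangle_ineq[of 1 "(X - of_real t) * (\<Sum>j<n. \<psi> j * of_real (poly (p j) t))"]
    by (simp add: norm_mult)
qed

lemma Q_cnj: "Q n (cnj x) (of_real y) = cnj (Q n x (of_real y))"
proof -
  have "pt n (of_real y) = of_real (x0 + y / n)"
    by (simp add: pt_def)
  then show ?thesis
    by (simp add: Q_def wronskian_def pt_cnj second_kind_cnj del: of_real_add)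
qed

lemma Q_diagonal: "n \<ge> 1 \<Longrightarrow> Q n x x = 1"
  unfolding Q_def wronskian_qp[OF recursion p_zero _ a_pos] by simp

lemma holomorphic_Q: "(\<lambda>x. Q n x y) holomorphic_on A"
  unfolding Q_def wronskian_def by (intro holomorphic_intros)

text \<open>
  The combination of sine and cosine for which \<open>E + L \<sigma> sin \<theta>\<close> is a multiple of \<open>exp (\<i> \<theta>)\<close>, and
  therefore bounded in the upper half plane when \<open>y\<close> is real.
\<close>

definition E :: "complex \<Rightarrow> complex \<Rightarrow> complex" where
  "E x y = of_real \<sigma> * (of_real (Im L) * cos (\<theta> x y) - of_real (Re L) * sin (\<theta> x y))"

lemma E_Weyl: "E x y + L * (of_real \<sigma> * sin (\<theta> x y)) = of_real (\<sigma> * Im L) * exp (\<i> * \<theta> x y)"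
proof -
  have "L * (of_real \<sigma> * sin (\<theta> x y)) =
      of_real \<sigma> * (of_real (Re L) + \<i> * of_real (Im L)) * sin (\<theta> x y)"
    using complex_eq[of L] by (simp add: mult_ac)
  then show ?thesis
    unfolding E_def exp_Euler by (simp add: algebra_simps)
qed

lemma E_cnj: "E (cnj x) (of_real y) = cnj (E x (of_real y))"
proof -
  have "\<theta> (cnj x) (of_real y) = cnj (\<theta> x (of_real y))"
    by (simp add: \<theta>_def)
  then show ?thesis
    by (simp add: E_def cnj_cos cnj_sin)
qed

lemma holomorphic_E: "(\<lambda>x. E x y) holomorphic_on A"
  unfolding E_def \<theta>_def by (intro holomorphic_intros)

text \<open>
  At \<open>x\<close> off the real axis, the bound on \<open>Q + F S\<close> and the Harnack bound on \<open>F\<close> give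
  \<open>\<bar>Im x\<bar> \<bar>Q\<bar> \<le> B\<close> uniformly in \<open>n\<close>, in the lower half plane by reflection. As \<open>Q\<close> is entire in
  \<open>x\<close>, this bounds it across the real axis.
\<close>

lemma Q_locally_bounded:
  assumes K: "compact K"
  shows "\<exists>B. \<forall>\<^sub>F n in sequentially. \<forall>x\<in>K. cmod (Q n x (of_real y)) \<le> B"
proof -
  obtain R0 where R0: "\<And>x. x \<in> K \<Longrightarrow> cmod x \<le> R0"
    using compact_imp_bounded[OF K] by (auto simp: bounded_iff)
  define R where "R = 2 * (\<bar>R0\<bar> + 1)"
  have R: "R > 0" and KR: "\<And>x. x \<in> K \<Longrightarrow> cmod x \<le> R / 2"
    using R0 by (auto simp: R_def) (smt (verit))
  define C where "C = cmod L + 1"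
  define D where "D = \<rho> / w0 + 1"
  have "bounded ((\<lambda>(x, y). of_real \<sigma> * sin (\<theta> x y)) ` (cball 0 R \<times> {complex_of_real y}))"
    unfolding \<theta>_def case_prod_unfold
    by (intro bounded_image_continuous compact_Times compact_cball continuous_intros) auto
  then obtain T where T: "\<And>x. cmod x \<le> R \<Longrightarrow> cmod (of_real \<sigma> * sin (\<theta> x (of_real y))) \<le> T"
    by (force simp: bounded_iff)
  \<comment> \<open>eventual bounds, on the circle of radius \<open>R\<close>, for \<open>\<bar>Im z\<bar> \<bar>F n z\<bar>\<close> and then for
    \<open>\<bar>Im z\<bar> \<bar>Q n z y\<bar>\<close>\<close>
  define C1 where "C1 = C * R + (R + 1) * (2 * R + 1) * C"
  define B where "B = R + (R + \<bar>y\<bar>) * (sqrt C1 * sqrt D) + C1 * (T + 1)"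
  have C: "C \<ge> 1" and D: "D \<ge> 0"
    using rho_pos w0_pos by (auto simp: C_def D_def)
  have C1: "C1 \<ge> 0"
    using R C by (simp add: C1_def)
  have T0: "T \<ge> 0"
    using order_trans[OF norm_ge_zero T[of 0]] R by simp
  have B0: "B \<ge> 0"
    unfolding B_def using R C1 D T0 by (intro add_nonneg_nonneg mult_nonneg_nonneg) auto
  have "(\<lambda>n. cmod (F n \<i>)) \<longlonglongrightarrow> cmod L"
    by (intro tendsto_intros F_tendsto) simp
  then have ev1: "\<forall>\<^sub>F n in sequentially. cmod (F n \<i>) < C"
    by (rule order_tendstoD) (simp add: C_def)
  have ev2: "\<forall>\<^sub>F n in sequentially. \<kappa> n y < D"
    by (rule order_tendstoD[OF kappa_tendsto]) (simp add: D_def)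
  have ev3: "\<forall>\<^sub>F n in sequentially. \<forall>x\<in>cball 0 R. cmod (S n x (of_real y)) < T + 1"
    using uniform_limitD[OF S_uniform_limit[OF compact_cball[of 0 R], of "{complex_of_real y}"], of 1]
  proof (rule eventually_mono)
    fix n
    assume H: "\<forall>z\<in>cball 0 R \<times> {complex_of_real y}.
      dist (case z of (x, y) \<Rightarrow> S n x y) (case z of (x, y) \<Rightarrow> of_real \<sigma> * sin (\<theta> x y)) < 1"
    show "\<forall>x\<in>cball 0 R. cmod (S n x (of_real y)) < T + 1"
    proof
      fix x :: complex
      assume x: "x \<in> cball 0 R"
      then have "dist (S n x (of_real y)) (of_real \<sigma> * sin (\<theta> x (of_real y))) < 1"
        using H by force
      then show "cmod (S n x (of_real y)) < T + 1"
        using T[of x] x norm_triangle_sub[of "S n x (of_real y)" "of_real \<sigma> * sin (\<theta> x (of_real y))"]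
        by (simp add: dist_norm)
    qed
  qed simp_all
  show ?thesis
  proof (intro exI)
    show "\<forall>\<^sub>F n in sequentially. \<forall>x\<in>K. cmod (Q n x (of_real y)) \<le> 8 * B / (3 * R)"
      using ev1 ev2 ev3 eventually_ge_at_top[of 1]
    proof eventually_elim
      case (elim n)
      have upper: "Im z * cmod (Q n z (of_real y)) \<le> B" if z: "cmod z = R" "Im z > 0" for z
      proof -
        have zR: "Im z \<le> R"
          using abs_Im_le_cmod[of z] z by simp
        have zi: "cmod (z - \<i>) \<le> R + 1"
          using norm_triangle_ineq4[of z \<i>] z by simp
        have ImFi: "Im (F n \<i>) \<le> C" "0 \<le> Im (F n \<i>)"
          using elim abs_Im_le_cmod[of "F n \<i>"]
          by (auto simp: F_def Im_pt intro!: Im_stieltjes_nonneg)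
        have "Im z * cmod (F n z - F n \<i>) \<le>
            Im z * (cmod (z - \<i>) * ((1 + cmod (z - \<i>) / Im z) * Im (F n \<i>)))"
          using F_harnack[of n z \<i>] elim z by (intro mult_left_mono) auto
        also have "\<dots> = cmod (z - \<i>) * (Im z + cmod (z - \<i>)) * Im (F n \<i>)"
          using z by (simp add: field_simps)
        also have "\<dots> \<le> (R + 1) * (2 * R + 1) * C"
          using zi zR z ImFi R C by (intro mult_mono) auto
        finally have "Im z * cmod (F n z - F n \<i>) \<le> (R + 1) * (2 * R + 1) * C" .
        moreover have "Im z * cmod (F n \<i>) \<le> R * C"
          using zR z elim R by (intro mult_mono) auto
        moreover have "Im z * cmod (F n z) \<le> Im z * (cmod (F n z - F n \<i>) + cmod (F n \<i>))"
          using z norm_triangle_sub[of "F n z" "F n \<i>"] by (intro mult_left_mono) auto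
        ultimately have Fz: "Im z * cmod (F n z) \<le> C1"
          by (simp add: C1_def algebra_simps)
        have "Im z * sqrt (Im (F n z) / Im z) = sqrt (Im z * Im (F n z))"
        proof -
          have "Im z * sqrt (Im (F n z) / Im z) = sqrt (Im z * Im z) * sqrt (Im (F n z) / Im z)"
            using z by simp
          also have "\<dots> = sqrt (Im z * Im z * (Im (F n z) / Im z))"
            by (rule real_sqrt_mult[symmetric])
          finally show ?thesis using z by simp
        qed
        also have "\<dots> \<le> sqrt C1"
        proof -
          have "Im z * Im (F n z) \<le> Im z * cmod (F n z)"
            using z abs_Im_le_cmod[of "F n z"] by (intro mult_left_mono) auto
          then show ?thesis using Fz by simp
        qed
        finally have sq: "Im z * sqrt (Im (F n z) / Im z) \<le> sqrt C1" .
        have "cmod (Q n z (of_real y)) \<le>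
            cmod (Q n z (of_real y) + F n z * S n z (of_real y)) + cmod (F n z) * cmod (S n z (of_real y))"
          using norm_triangle_sub[of "Q n z (of_real y)" "- (F n z * S n z (of_real y))"]
          by (simp add: norm_mult)
        also have "\<dots> \<le> 1 + cmod (z - of_real y) * (sqrt (Im (F n z) / Im z) * sqrt (\<kappa> n y)) +
            cmod (F n z) * cmod (S n z (of_real y))"
          using Q_Weyl_bound[of n z y] elim z by simp
        finally have "Im z * cmod (Q n z (of_real y)) \<le> Im z *
            (1 + cmod (z - of_real y) * (sqrt (Im (F n z) / Im z) * sqrt (\<kappa> n y)) +
            cmod (F n z) * cmod (S n z (of_real y)))"
          using z by (intro mult_left_mono) auto
        also have "\<dots> = Im z + cmod (z - of_real y) * ((Im z * sqrt (Im (F n z) / Im z)) * sqrt (\<kappa> n y)) +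
            (Im z * cmod (F n z)) * cmod (S n z (of_real y))"
          by (simp only: distrib_left mult_1_right mult_ac)
        also have "\<dots> \<le> B"
          unfolding B_def
        proof (intro add_mono mult_mono zR sq Fz)
          show "cmod (z - of_real y) \<le> R + \<bar>y\<bar>"
            using norm_triangle_ineq4[of z "of_real y"] z by simp
          show "sqrt (\<kappa> n y) \<le> sqrt D"
            using elim by simp
          show "cmod (S n z (of_real y)) \<le> T + 1"
            using elim z by (auto intro: less_imp_le)
          have "cd_kernel p n (pt n (of_real y)) (pt n (of_real y)) =
              of_real (\<Sum>j<n. (poly (p j) (x0 + y / n))\<^sup>2)"
            using cpoly_of_real[of _ "x0 + y / n"]
            by (simp add: cd_kernel_def cpoly_def[symmetric] pt_def power2_eq_square del: cpoly_of_real)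
          then show "0 \<le> sqrt (\<kappa> n y)"
            unfolding \<kappa>_def by (simp add: sum_nonneg)
          have "0 \<le> Im (F n z)"
            using elim z by (auto simp: F_def Im_pt intro!: Im_stieltjes_nonneg)
          then show "0 \<le> Im z * sqrt (Im (F n z) / Im z) * sqrt (\<kappa> n y)"
            using \<open>0 \<le> sqrt (\<kappa> n y)\<close> z by simp
        qed (use R C1 D in auto)
        finally show ?thesis .
      qed
      show ?case
      proof
        fix x
        assume "x \<in> K"
        show "cmod (Q n x (of_real y)) \<le> 8 * B / (3 * R)"
        proof (rule bound_off_real_axis[OF holomorphic_Q R _ B0 KR[OF \<open>x \<in> K\<close>]])
          fix z :: complex
          assume z: "cmod z = R" "Im z \<noteq> 0"
          show "\<bar>Im z\<bar> * cmod (Q n z (of_real y)) \<le> B"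
          proof (cases "Im z > 0")
            case True
            then show ?thesis using upper[of z] z by simp
          next
            case False
            then show ?thesis using upper[of "cnj z"] z by (simp add: Q_cnj)
          qed
        qed
      qed
    qed
  qed
qed

text \<open>
  In the limit \<open>F\<close> becomes the constant \<open>L\<close>, so a limit \<open>h\<close> of \<open>Q\<close> and the explicit function \<open>E\<close>
  both compensate the exponential growth of \<open>L \<sigma> sin \<theta>\<close>. Their difference satisfies the hypothesis
  of the Liouville lemma above and is constant; its value is read off at \<open>x = y\<close>, where
  \<open>Q = 1\<close>.
\<close>

lemma Q_subsequential_limit:
  assumes r: "strict_mono (r :: nat \<Rightarrow> nat)" and h: "h holomorphic_on UNIV"
    and lim: "\<And>x. (\<lambda>n. Q (r n) x (of_real y)) \<longlonglongrightarrow> h x"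
  shows "h x = E x (of_real y) + of_real (1 - \<sigma> * Im L)"
proof -
  define G where "G z = h z - E z (of_real y)" for z
  define c where "c = 1 + \<sigma> * Im L + sqrt (Im L) * sqrt (\<rho> / w0)"
  have pos: "0 \<le> \<sigma> * Im L" "0 \<le> sqrt (Im L) * sqrt (\<rho> / w0)"
    using sigma_pos Im_L_nonneg rho_pos w0_pos by auto
  have upper: "cmod (G z) \<le> c * (1 + (cmod z + \<bar>y\<bar>) / sqrt (Im z))" if z: "Im z > 0" for z
  proof -
    have sub: "(\<lambda>n. f (r n)) \<longlonglongrightarrow> l" if "f \<longlonglongrightarrow> l" for f :: "nat \<Rightarrow> 'z::topological_space" and l
      using LIMSEQ_subseq_LIMSEQ[OF that r] by (simp add: o_def)
    have "(\<lambda>n. cmod (Q (r n) z (of_real y) + F (r n) z * S (r n) z (of_real y))) \<longlonglongrightarrow>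
        cmod (h z + L * (of_real \<sigma> * sin (\<theta> z (of_real y))))"
      by (intro tendsto_norm tendsto_add tendsto_mult lim sub[OF F_tendsto[OF z]] sub[OF S_tendsto])
    moreover have "(\<lambda>n. 1 + cmod (z - of_real y) * (sqrt (Im (F (r n) z) / Im z) * sqrt (\<kappa> (r n) y))) \<longlonglongrightarrow>
        1 + cmod (z - of_real y) * (sqrt (Im L / Im z) * sqrt (\<rho> / w0))"
      using z by (intro tendsto_intros tendsto_real_sqrt sub[OF F_tendsto[OF z]] sub[OF kappa_tendsto]) auto
    moreover have "\<forall>\<^sub>F n in sequentially. cmod (Q (r n) z (of_real y) + F (r n) z * S (r n) z (of_real y)) \<le>
        1 + cmod (z - of_real y) * (sqrt (Im (F (r n) z) / Im z) * sqrt (\<kappa> (r n) y))"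
      using eventually_ge_at_top[of 1]
    proof eventually_elim
      case (elim n)
      then have "r n \<ge> 1"
        using strict_mono_imp_increasing[OF r, of n] by simp
      then show ?case
        using Q_Weyl_bound z by blast
    qed
    ultimately have "cmod (h z + L * (of_real \<sigma> * sin (\<theta> z (of_real y)))) \<le>
        1 + cmod (z - of_real y) * (sqrt (Im L / Im z) * sqrt (\<rho> / w0))"
      by (intro tendsto_le[OF sequentially_bot]) auto
    also have "h z + L * (of_real \<sigma> * sin (\<theta> z (of_real y))) =
        G z + of_real (\<sigma> * Im L) * exp (\<i> * \<theta> z (of_real y))"
      using E_Weyl[of z "of_real y"] by (simp add: G_def algebra_simps)
    finally have "cmod (G z) \<le> 1 + cmod (z - of_real y) * (sqrt (Im L / Im z) * sqrt (\<rho> / w0)) +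
        cmod (of_real (\<sigma> * Im L) * exp (\<i> * \<theta> z (of_real y)))"
      using norm_triangle_sub[of "G z" "- (of_real (\<sigma> * Im L) * exp (\<i> * \<theta> z (of_real y)))"] by simp
    also have "cmod (of_real (\<sigma> * Im L) * exp (\<i> * \<theta> z (of_real y))) \<le> \<sigma> * Im L * 1"
    proof -
      have "Re (\<i> * \<theta> z (of_real y)) \<le> 0"
        using rho_pos z by (simp add: \<theta>_def)
      then show ?thesis
        using pos sigma_pos Im_L_nonneg by (simp add: norm_mult abs_mult[symmetric] mult_left_le)
    qed
    also have "cmod (z - of_real y) * (sqrt (Im L / Im z) * sqrt (\<rho> / w0)) \<le>
        (cmod z + \<bar>y\<bar>) * (sqrt (Im L / Im z) * sqrt (\<rho> / w0))"
      using norm_triangle_ineq4[of z "of_real y"] Im_L_nonneg z rho_pos w0_pos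
      by (intro mult_right_mono) auto
    also have "1 + (cmod z + \<bar>y\<bar>) * (sqrt (Im L / Im z) * sqrt (\<rho> / w0)) + \<sigma> * Im L * 1 \<le>
        c * (1 + (cmod z + \<bar>y\<bar>) / sqrt (Im z))"
    proof -
      define u where "u = (cmod z + \<bar>y\<bar>) / sqrt (Im z)"
      have u: "u \<ge> 0"
        using z by (simp add: u_def)
      have "(cmod z + \<bar>y\<bar>) * (sqrt (Im L / Im z) * sqrt (\<rho> / w0)) = (sqrt (Im L) * sqrt (\<rho> / w0)) * u"
        by (simp add: u_def real_sqrt_divide mult_ac)
      moreover have "(sqrt (Im L) * sqrt (\<rho> / w0)) * u \<le> c * u"
        using u pos by (intro mult_right_mono) (auto simp: c_def)
      moreover have "1 + \<sigma> * Im L \<le> c"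
        using pos by (simp add: c_def)
      ultimately show ?thesis
        unfolding u_def[symmetric] distrib_left mult_1_right by linarith
    qed
    finally show ?thesis by simp
  qed
  have h_cnj: "h (cnj z) = cnj (h z)" for z
  proof (rule LIMSEQ_unique[OF lim])
    show "(\<lambda>n. Q (r n) (cnj z) (of_real y)) \<longlonglongrightarrow> cnj (h z)"
      unfolding Q_cnj by (intro tendsto_cnj lim)
  qed
  have "G x = G (of_real y)"
  proof (rule liouville_off_real_axis[where f = G and c = c and d = "\<bar>y\<bar>"])
    show "G holomorphic_on UNIV"
      unfolding G_def by (intro holomorphic_intros h holomorphic_E)
    show "c \<ge> 0" "\<bar>y\<bar> \<ge> 0"
      using pos by (auto simp: c_def)
    fix z :: complex
    assume z: "Im z \<noteq> 0"
    show "cmod (G z) \<le> c * (1 + (cmod z + \<bar>y\<bar>) / sqrt \<bar>Im z\<bar>)"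
    proof (cases "Im z > 0")
      case True
      then show ?thesis using upper[of z] by simp
    next
      case False
      have "G (cnj z) = cnj (G z)"
        by (simp add: G_def h_cnj E_cnj)
      then show ?thesis using upper[of "cnj z"] False z by simp
    qed
  qed
  moreover have "h (of_real y) = 1"
  proof (rule LIMSEQ_unique[OF lim])
    have "\<forall>\<^sub>F n in sequentially. Q (r n) (of_real y) (of_real y) = 1"
      using eventually_ge_at_top[of 1]
    proof eventually_elim
      case (elim n)
      then show ?case
        using strict_mono_imp_increasing[OF r, of n] by (simp add: Q_diagonal)
    qed
    then show "(\<lambda>n. Q (r n) (of_real y) (of_real y)) \<longlonglongrightarrow> 1"
      by (rule tendsto_eventually)
  qed
  ultimately have "G x = 1 - of_real (\<sigma> * Im L)"
    by (simp add: G_def E_def \<theta>_def)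
  then show ?thesis
    by (simp add: G_def algebra_simps)
qed

lemma Q_uniform_limit_aux:
  assumes "compact K"
  shows "uniform_limit K (\<lambda>n x. Q n x (of_real y))
     (\<lambda>x. E x (of_real y) + of_real (1 - \<sigma> * Im L)) sequentially"
proof (rule uniform_limit_by_normality[of UNIV])
  show "\<exists>B. \<forall>\<^sub>F n in sequentially. \<forall>z\<in>K. cmod (Q n z (of_real y)) \<le> B" if "compact K" for K
    using that by (rule Q_locally_bounded)
  show "h z = E z (of_real y) + of_real (1 - \<sigma> * Im L)"
    if "strict_mono r" "h holomorphic_on UNIV" "\<And>z. z \<in> UNIV \<Longrightarrow> (\<lambda>n. Q (r n) z (of_real y)) \<longlonglongrightarrow> h z"
    for r :: "nat \<Rightarrow> nat" and h z
    by (rule Q_subsequential_limit[OF that(1,2)]) (use that(3) in simp)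
qed (use assms holomorphic_Q in auto)

text \<open>
  The functions \<open>sin \<theta>\<close> and \<open>cos \<theta>\<close> satisfy the limiting Pluecker relation between the second
  solution and three polynomial solutions, while a nonzero constant does not. So the constant
  \<open>1 - \<sigma> Im L\<close> vanishes. In particular \<open>L\<close> is not real.
\<close>

lemma Im_boundary_value: "Im L = pi * w0"
proof -
  \<comment> \<open>chosen to make \<open>\<theta> 0 c = - pi / 2\<close> and \<open>\<theta> 0 d = - pi\<close>\<close>
  define c where "c = complex_of_real (1 / (2 * \<rho>))"
  define d where "d = complex_of_real (1 / \<rho>)"
  have Q_tendsto: "(\<lambda>n. Q n x (of_real y)) \<longlonglongrightarrow> E x (of_real y) + of_real (1 - \<sigma> * Im L)" for x y
    by (rule tendsto_uniform_limitI[OF Q_uniform_limit_aux[of "{x}" y]]) simp_all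
  have "Q n 0 0 * S n c d = Q n 0 c * S n 0 d - Q n 0 d * S n 0 c" for n
    unfolding Q_def S_def by (rule wronskian_plucker)
  then have "(\<lambda>n. Q n 0 (of_real 0) * S n c d - (Q n 0 c * S n 0 d - Q n 0 d * S n 0 c)) \<longlonglongrightarrow> 0"
    by simp
  moreover have "(\<lambda>n. Q n 0 (of_real 0) * S n c d - (Q n 0 c * S n 0 d - Q n 0 d * S n 0 c)) \<longlonglongrightarrow>
      (E 0 (of_real 0) + of_real (1 - \<sigma> * Im L)) * (of_real \<sigma> * sin (\<theta> c d)) -
      ((E 0 c + of_real (1 - \<sigma> * Im L)) * (of_real \<sigma> * sin (\<theta> 0 d)) -
       (E 0 d + of_real (1 - \<sigma> * Im L)) * (of_real \<sigma> * sin (\<theta> 0 c)))"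
    unfolding c_def d_def by (intro tendsto_diff tendsto_mult Q_tendsto S_tendsto)
  ultimately have eq: "(E 0 (of_real 0) + of_real (1 - \<sigma> * Im L)) * (of_real \<sigma> * sin (\<theta> c d)) -
      ((E 0 c + of_real (1 - \<sigma> * Im L)) * (of_real \<sigma> * sin (\<theta> 0 d)) -
       (E 0 d + of_real (1 - \<sigma> * Im L)) * (of_real \<sigma> * sin (\<theta> 0 c))) = 0"
    using LIMSEQ_unique by blast
  have "\<theta> c d = of_real (- (pi / 2))" "\<theta> 0 d = of_real (- pi)" "\<theta> 0 c = of_real (- (pi / 2))"
    "\<theta> 0 0 = 0"
    using rho_pos by (simp_all add: \<theta>_def c_def d_def field_simps)
  then have trig: "sin (\<theta> c d) = - 1" "sin (\<theta> 0 d) = 0" "cos (\<theta> 0 d) = - 1" "sin (\<theta> 0 c) = - 1"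
    "sin (\<theta> 0 0) = 0" "cos (\<theta> 0 0) = 1"
    by (simp_all only: sin_of_real cos_of_real sin_minus cos_minus sin_pi_half sin_pi cos_pi
        of_real_minus of_real_1 minus_zero of_real_0 sin_zero cos_zero)
  have "of_real (\<sigma> * (2 - 2 * (\<sigma> * Im L))) = (0 :: complex)"
    using eq unfolding E_def of_real_0 trig by (simp add: algebra_simps)
  then have "\<sigma> * Im L = 1"
    using sigma_pos by (simp only: of_real_eq_0_iff) simp
  then show ?thesis
    using w0_pos by (simp add: \<sigma>_def field_simps)
qed

lemma Q_uniform_limit:
  assumes "compact K"
  shows "uniform_limit K (\<lambda>n x. Q n x (of_real y))
     (\<lambda>x. cos (\<theta> x (of_real y)) - of_real (\<sigma> * Re L) * sin (\<theta> x (of_real y))) sequentially"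
proof -
  have "\<sigma> * Im L = 1"
    using w0_pos by (simp add: Im_boundary_value \<sigma>_def)
  then have "complex_of_real \<sigma> * complex_of_real (Im L) = 1"
    by (metis of_real_1 of_real_mult)
  then have "E x (of_real y) + of_real (1 - \<sigma> * Im L) =
      cos (\<theta> x (of_real y)) - of_real (\<sigma> * Re L) * sin (\<theta> x (of_real y))" for x
    using \<open>\<sigma> * Im L = 1\<close> by (simp add: E_def right_diff_distrib flip: mult.assoc)
  then show ?thesis
    using Q_uniform_limit_aux[OF assms, of y] by simp
qed

text \<open>
  \<open>X\<close> is the Wronskian of a perturbed with an unperturbed polynomial solution, so its limit \<open>X'\<close> is
  known, and \<open>T\<close>, the Wronskian of two perturbed ones, follows from it by the Pluecker relation
  relative to the unperturbed solutions at \<open>0\<close> and \<open>c\<close>. The angle addition formula turns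
  the limit into a multiple of \<open>sin \<theta>\<close>, with a factor in which \<open>\<sigma> Im L = 1\<close> produces
  \<open>\<bar>1 + \<beta> L\<bar>\<^sup>2\<close>.
\<close>

lemma perturbed_kernel_scaling:
  fixes \<beta> :: real
  assumes q: "jacobi_recursion q a (\<lambda>n. b n + \<beta> * (if n = 1 then 1 else 0))" "q 0 = 1"
    and w: "w = w0 / (cmod (1 + of_real \<beta> * L))\<^sup>2"
  shows "sine_kernel_asymptotics q x0 \<rho> w"
proof -
  let ?b = "\<lambda>n. b n + \<beta> * (if n = 1 then 1 else 0)"
  define \<alpha> where "\<alpha> = \<sigma> * (1 + \<beta> * Re L)"
  define X where "X n x y = wronskian a n (\<lambda>j. cpoly (q j) (pt n x)) (\<lambda>j. cpoly (p j) (pt n y))" for n x y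
  define X' where "X' x y = of_real \<alpha> * sin (\<theta> x y) - of_real \<beta> * cos (\<theta> x y)" for x y
  define T where "T n x y = wronskian a n (\<lambda>j. cpoly (q j) (pt n x)) (\<lambda>j. cpoly (q j) (pt n y))" for n x y
  \<comment> \<open>a quarter period, for which the limit \<open>- \<sigma>\<close> of \<open>S n 0 c\<close> is nonzero\<close>
  define \<gamma> where "\<gamma> = 1 / (2 * \<rho>)"
  define c where "c = complex_of_real \<gamma>"
  have cpoly_q: "cpoly (q j) z = 1 * cpoly (p j) z + (- of_real \<beta>) * second_kind a b z j" for j z
    using perturbed_polynomials[OF recursion p_zero a_pos q, of j z] by simp
  have X_eq: "X n x y = S n x y - of_real \<beta> * Q n x y" for n x y
    unfolding X_def S_def Q_def cpoly_q wronskian_linear by simp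
  have X_lim: "uniform_limit K (\<lambda>n x. X n x (of_real y)) (\<lambda>x. X' x (of_real y)) sequentially"
    if K: "compact K" for K y
  proof -
    have "uniform_limit K (\<lambda>n x. S n x (of_real y)) (\<lambda>x. of_real \<sigma> * sin (\<theta> x (of_real y))) sequentially"
      using S_uniform_limit[OF K, of "{of_real y}"] by (auto simp: uniform_limit_iff)
    moreover have "uniform_limit K (\<lambda>n x. of_real \<beta> * Q n x (of_real y))
        (\<lambda>x. of_real \<beta> * (cos (\<theta> x (of_real y)) - of_real (\<sigma> * Re L) * sin (\<theta> x (of_real y)))) sequentially"
      by (intro bounded_linear.uniform_limit[OF bounded_linear_mult_right] Q_uniform_limit[OF K])
    ultimately have "uniform_limit K (\<lambda>n x. S n x (of_real y) - of_real \<beta> * Q n x (of_real y))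
        (\<lambda>x. of_real \<sigma> * sin (\<theta> x (of_real y)) -
          of_real \<beta> * (cos (\<theta> x (of_real y)) - of_real (\<sigma> * Re L) * sin (\<theta> x (of_real y)))) sequentially"
      by (rule uniform_limit_minus)
    then show ?thesis
      unfolding X_eq X'_def \<alpha>_def by (simp add: algebra_simps)
  qed
  have X_bounded: "bounded ((\<lambda>x. X' x y) ` K)" if "compact K" for K y
    unfolding X'_def \<theta>_def
    by (intro bounded_image_continuous that continuous_intros)
  have plucker: "T n x y * S n 0 c = X n x 0 * X n y c - X n x c * X n y 0" for n x y
    unfolding T_def S_def X_def by (rule wronskian_plucker)
  have S0c: "(\<lambda>n. S n 0 c) \<longlonglongrightarrow> - of_real \<sigma>"
  proof -
    have "\<theta> 0 c = of_real (- (pi / 2))"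
      using rho_pos by (simp add: \<theta>_def c_def \<gamma>_def)
    then have "sin (\<theta> 0 c) = - 1"
      by (simp only: sin_of_real sin_minus sin_pi_half of_real_minus of_real_1)
    then show ?thesis
      using S_tendsto[of 0 c] by simp
  qed
  have limit: "X' x 0 * X' y c - X' x c * X' y 0 = - of_real (\<alpha>\<^sup>2 + \<beta>\<^sup>2) * sin (\<theta> x y)" for x y
  proof -
    define u where "u = of_real (pi * \<rho>) * x"
    define v where "v = of_real (pi * \<rho>) * y"
    have \<theta>: "\<theta> x 0 = u" "\<theta> y 0 = v" "\<theta> x y = u - v"
      by (simp_all add: \<theta>_def u_def v_def algebra_simps)
    have \<theta>c: "\<theta> x c = u - of_real pi / 2" "\<theta> y c = v - of_real pi / 2"
      using rho_pos by (simp_all add: \<theta>_def u_def v_def c_def \<gamma>_def right_diff_distrib)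
    have sc: "sin (z - of_real pi / 2) = - cos z" "cos (z - of_real pi / 2) = sin z" for z :: complex
      by (simp_all add: sin_diff cos_diff sin_of_real_pi_half cos_of_real_pi_half)
    show ?thesis
      unfolding X'_def \<theta> \<theta>c sc sin_diff by (simp add: algebra_simps power2_eq_square)
  qed
  have T_lim: "uniform_limit (A \<times> B) (\<lambda>n (x, y). T n x y)
      (\<lambda>(x, y). of_real ((\<alpha>\<^sup>2 + \<beta>\<^sup>2) / \<sigma>) * sin (\<theta> x y)) sequentially"
    if A: "compact A" and B: "compact B" for A B
  proof -
    let ?P = "\<lambda>n z. X n (fst z) 0 * X n (snd z) c - X n (fst z) c * X n (snd z) 0"
    let ?P' = "\<lambda>z. X' (fst z) 0 * X' (snd z) c - X' (fst z) c * X' (snd z) 0"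
    have fst_lim: "uniform_limit (A \<times> B) (\<lambda>n z. X n (fst z) (of_real y)) (\<lambda>z. X' (fst z) (of_real y)) sequentially" for y
      using uniform_limit_fst[OF X_lim[OF A, of y], of B] by (simp add: case_prod_unfold)
    have snd_lim: "uniform_limit (A \<times> B) (\<lambda>n z. X n (snd z) (of_real y)) (\<lambda>z. X' (snd z) (of_real y)) sequentially" for y
      using uniform_limit_snd[OF X_lim[OF B, of y], of A] by (simp add: case_prod_unfold)
    have fst_bdd: "bounded ((\<lambda>z. X' (fst z) y) ` (A \<times> B))" for y
      by (rule bounded_subset[OF X_bounded[OF A, of y]]) auto
    have snd_bdd: "bounded ((\<lambda>z. X' (snd z) y) ` (A \<times> B))" for y
      by (rule bounded_subset[OF X_bounded[OF B, of y]]) auto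
    have P: "uniform_limit (A \<times> B) ?P ?P' sequentially"
      unfolding c_def
      by (intro uniform_limit_minus uniform_lim_mult fst_bdd snd_bdd
          fst_lim[of 0, unfolded of_real_0] snd_lim[of 0, unfolded of_real_0] fst_lim snd_lim)
    have P_bdd: "bounded (?P' ` (A \<times> B))"
      unfolding X'_def \<theta>_def
      by (intro bounded_image_continuous compact_Times A B continuous_intros)
    have inv: "(\<lambda>n. inverse (S n 0 c)) \<longlonglongrightarrow> inverse (- of_real \<sigma>)"
      using sigma_pos by (intro tendsto_inverse S0c) simp
    have ul: "uniform_limit (A \<times> B) (\<lambda>n z. inverse (S n 0 c) * ?P n z)
        (\<lambda>z. inverse (- of_real \<sigma>) * ?P' z) sequentially"
    proof (intro uniform_lim_mult uniform_limit_const_seq inv P P_bdd)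
      show "bounded ((\<lambda>_. inverse (- complex_of_real \<sigma>)) ` (A \<times> B))"
        by (rule bounded_subset[of "{inverse (- complex_of_real \<sigma>)}"]) auto
    qed
    have "\<forall>\<^sub>F n in sequentially. S n 0 c \<noteq> 0"
      using sigma_pos by (intro tendsto_imp_eventually_ne[OF S0c]) simp
    then have feq: "\<forall>\<^sub>F n in sequentially. \<forall>z\<in>A \<times> B. inverse (S n 0 c) * ?P n z = (case z of (x, y) \<Rightarrow> T n x y)"
    proof eventually_elim
      case (elim n)
      show ?case
      proof
        fix z
        have "inverse (S n 0 c) * (T n (fst z) (snd z) * S n 0 c) = T n (fst z) (snd z)"
          using elim by simp
        then show "inverse (S n 0 c) * ?P n z = (case z of (x, y) \<Rightarrow> T n x y)"
          unfolding plucker by (simp add: case_prod_unfold)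
      qed
    qed
    have leq: "inverse (- of_real \<sigma>) * ?P' z =
        (case z of (x, y) \<Rightarrow> of_real ((\<alpha>\<^sup>2 + \<beta>\<^sup>2) / \<sigma>) * sin (\<theta> x y))" for z
      unfolding limit using sigma_pos by (simp add: case_prod_unfold field_simps)
    show ?thesis
      by (rule iffD1[OF uniform_limit_cong[OF feq leq] ul])
  qed
  have factor: "(\<alpha>\<^sup>2 + \<beta>\<^sup>2) / \<sigma> = 1 / (pi * w)"
  proof -
    have "\<sigma> * Im L = 1"
      using w0_pos by (simp add: Im_boundary_value \<sigma>_def)
    then have "\<beta> = \<sigma> * (\<beta> * Im L)"
      by (simp add: mult.left_commute)
    then have "\<alpha>\<^sup>2 + \<beta>\<^sup>2 = (\<sigma> * (1 + \<beta> * Re L))\<^sup>2 + (\<sigma> * (\<beta> * Im L))\<^sup>2"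
      unfolding \<alpha>_def by (rule arg_cong)
    also have "\<dots> = \<sigma>\<^sup>2 * ((1 + \<beta> * Re L)\<^sup>2 + (\<beta> * Im L)\<^sup>2)"
      unfolding power_mult_distrib[of \<sigma>] distrib_left[of "\<sigma>\<^sup>2"] ..
    also have "(1 + \<beta> * Re L)\<^sup>2 + (\<beta> * Im L)\<^sup>2 = (cmod (1 + of_real \<beta> * L))\<^sup>2"
      by (simp add: cmod_power2)
    finally have "\<alpha>\<^sup>2 + \<beta>\<^sup>2 = \<sigma>\<^sup>2 * (cmod (1 + of_real \<beta> * L))\<^sup>2" .
    then have "(\<alpha>\<^sup>2 + \<beta>\<^sup>2) / \<sigma> = \<sigma> * (cmod (1 + of_real \<beta> * L))\<^sup>2"
      using sigma_pos by (simp add: power2_eq_square)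
    then show ?thesis
      by (simp add: w \<sigma>_def)
  qed
  define k where "k n x y = cd_kernel q n (pt n x) (pt n y) / of_nat n" for n x y
  define l where "l x y = sin_quotient (of_real (pi * \<rho>)) (y - x) / of_real (pi * w)" for x y
  have T_eq: "T n x y = (x - y) * k n x y" if "n \<ge> 1" for n x y
    unfolding T_def k_def wronskian_pp[OF q that] by (simp add: pt_diff)
  have l_eq: "of_real ((\<alpha>\<^sup>2 + \<beta>\<^sup>2) / \<sigma>) * sin (\<theta> x y) = (x - y) * l x y" for x y
    unfolding factor l_def \<theta>_def sin_quotient_mult[symmetric] by simp
  have "uniform_limit (A \<times> B) (\<lambda>n (x, y). k n x y) (\<lambda>(x, y). l x y) sequentially"
    if A: "compact A" and B: "compact B" for A B
  proof (rule uniform_limit_divide_diagonal[OF _ _ _ A B])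
    fix A' B' :: "complex set"
    assume AB: "compact A'" "compact B'"
    have feq: "\<forall>\<^sub>F n in sequentially. \<forall>z\<in>A' \<times> B'.
        (case z of (x, y) \<Rightarrow> T n x y) = (case z of (x, y) \<Rightarrow> (x - y) * k n x y)"
      using eventually_ge_at_top[of 1] by eventually_elim (auto simp: T_eq)
    have leq: "(case z of (x, y) \<Rightarrow> of_real ((\<alpha>\<^sup>2 + \<beta>\<^sup>2) / \<sigma>) * sin (\<theta> x y)) =
        (case z of (x, y) \<Rightarrow> (x - y) * l x y)" for z
      unfolding l_eq ..
    show "uniform_limit (A' \<times> B') (\<lambda>n (x, y). (x - y) * k n x y) (\<lambda>(x, y). (x - y) * l x y) sequentially"
      by (rule iffD1[OF uniform_limit_cong[OF feq leq] T_lim[OF AB]])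
  next
    show "k n x holomorphic_on UNIV" for n x
      unfolding k_def cd_kernel_def divide_inverse cpoly_def[symmetric]
      by (intro holomorphic_intros)
    have "sin_quotient (of_real (pi * \<rho>)) \<circ> (\<lambda>y. y - x) holomorphic_on UNIV" for x
      by (rule holomorphic_on_compose_gen[OF _ holomorphic_sin_quotient])
         (auto intro!: holomorphic_intros)
    then show "l x holomorphic_on UNIV" for x
      unfolding l_def divide_inverse by (intro holomorphic_intros) (simp add: o_def)
  qed
  then show ?thesis
    unfolding sine_kernel_asymptotics_def k_def l_def pt_def by (intro allI impI)
qed

end

section \<open>Universality for the perturbed measure\<close>

theorem theorem1p4:
  fixes \<mu> \<mu>\<beta> :: "real measure"
    and w w\<beta> :: "real \<Rightarrow> real"
    and a b :: "nat \<Rightarrow> real"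
    and p p\<beta> :: "nat \<Rightarrow> real poly"
    and x0 \<rho> \<beta> :: real
  assumes "compact_nontrivial_prob \<mu>"
    and "is_weight \<mu> w"
    and "orthonormal_polys \<mu> p"
    and "jacobi_parameters \<mu> a b"
    and "strong_lebesgue_point \<mu> w x0"
    and "\<rho> > 0"
    and "sine_kernel_asymptotics p x0 \<rho> (w x0)"
    and "compact_nontrivial_prob \<mu>\<beta>"
    and "orthonormal_polys \<mu>\<beta> p\<beta>"
    and "jacobi_parameters \<mu>\<beta> a (\<lambda>n. b n + \<beta> * (if n = 1 then 1 else 0))"
    and "is_weight \<mu>\<beta> w\<beta>"
    and "w\<beta> x0 = Lim (at_right 0) (\<lambda>\<epsilon>. Im (stieltjes \<mu>\<beta> (Complex x0 \<epsilon>)) / pi)"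
  shows "((\<lambda>\<epsilon>. Im (stieltjes \<mu>\<beta> (Complex x0 \<epsilon>)) / pi) \<longlongrightarrow> w\<beta> x0) (at_right 0) \<and>
    w\<beta> x0 = w x0 / (1 + 2 * \<beta> * Re (stieltjes_bdry \<mu> x0)
                       + \<beta>\<^sup>2 * (cmod (stieltjes_bdry \<mu> x0))\<^sup>2) \<and>
    w\<beta> x0 \<noteq> 0 \<and>
    sine_kernel_asymptotics p\<beta> x0 \<rho> (w\<beta> x0)"
proof -
  have M: "real_distribution \<mu>" and N: "real_distribution \<mu>\<beta>"
    using assms(1,8)
    by (auto simp: compact_nontrivial_prob_def real_distribution_def real_distribution_axioms_def)
  have bor: "sets \<mu> = sets borel" "sets \<mu>\<beta> = sets borel"
    using assms(1,8) by (auto simp: compact_nontrivial_prob_def)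
  have a: "\<forall>n\<ge>1. a n > 0" "bounded (a ` {1..})"
    using assms(4) by (auto simp: jacobi_parameters_def)
  have rec: "jacobi_recursion p a b"
    and rec': "jacobi_recursion p\<beta> a (\<lambda>n. b n + \<beta> * (if n = 1 then 1 else 0))"
    using jacobi_parameters_recursion[OF assms(3,4) bor(1)]
      jacobi_parameters_recursion[OF assms(9,10) bor(2)] by blast+
  have p0: "p\<beta> 0 = 1"
    using orthonormal_poly_zero[OF _ assms(9)] N by (simp add: real_distribution_def)
  obtain L where L: "((\<lambda>\<epsilon>. stieltjes \<mu> (Complex x0 \<epsilon>)) \<longlongrightarrow> L) (at_right 0)"
    using assms(5) unfolding strong_lebesgue_point_def by blast
  have bdry: "stieltjes_bdry \<mu> x0 = L"
    unfolding stieltjes_bdry_def using L by (intro tendsto_Lim) auto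
  have w: "w x0 > 0"
    using assms(5) by (simp add: strong_lebesgue_point_def)
  interpret bulk_scaling \<mu> p a b x0 \<rho> "w x0" L
    using M assms(3,6,7) rec a(1) w L by (auto simp: bulk_scaling_def bulk_scaling_axioms_def)
  have ImL: "Im L = pi * w x0"
    by (rule Im_boundary_value)
  define D where "D = 1 + of_real \<beta> * L"
  have D: "D \<noteq> 0"
  proof
    assume "D = 0"
    then have "\<beta> * Im L = 0" "1 + \<beta> * Re L = 0"
      by (auto simp: D_def complex_eq_iff)
    then show False
      using ImL w by auto
  qed
  have normD: "(cmod D)\<^sup>2 = 1 + 2 * \<beta> * Re L + \<beta>\<^sup>2 * (cmod L)\<^sup>2"
    unfolding D_def cmod_power2 by (simp add: power2_eq_square algebra_simps)
  have "((\<lambda>\<epsilon>. stieltjes \<mu> (Complex x0 \<epsilon>) / (1 + of_real \<beta> * stieltjes \<mu> (Complex x0 \<epsilon>))) \<longlongrightarrow> L / D)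
      (at_right 0)"
    using D unfolding D_def by (intro tendsto_intros L) auto
  moreover have "\<forall>\<^sub>F \<epsilon> in at_right 0. stieltjes \<mu> (Complex x0 \<epsilon>) / (1 + of_real \<beta> * stieltjes \<mu> (Complex x0 \<epsilon>)) =
      stieltjes \<mu>\<beta> (Complex x0 \<epsilon>)"
    using eventually_at_right_less[of "0::real"]
  proof eventually_elim
    case (elim \<epsilon>)
    let ?z = "Complex x0 \<epsilon>"
    have eq: "stieltjes \<mu>\<beta> ?z * (1 + of_real \<beta> * stieltjes \<mu> ?z) = stieltjes \<mu> ?z"
      by (rule stieltjes_perturbation[OF M assms(3) rec N assms(9) rec' a]) (use elim in simp)
    then have "1 + of_real \<beta> * stieltjes \<mu> ?z \<noteq> 0"
      by auto
    then show ?case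
      using eq by (simp add: field_simps)
  qed
  ultimately have "((\<lambda>\<epsilon>. stieltjes \<mu>\<beta> (Complex x0 \<epsilon>)) \<longlongrightarrow> L / D) (at_right 0)"
    by (rule Lim_transform_eventually)
  then have lim: "((\<lambda>\<epsilon>. Im (stieltjes \<mu>\<beta> (Complex x0 \<epsilon>)) / pi) \<longlongrightarrow> Im (L / D) / pi) (at_right 0)"
    by (intro tendsto_intros) auto
  have "Im (L / D) = Im L / (cmod D)\<^sup>2"
    by (simp add: Im_divide cmod_power2[symmetric]) (simp add: D_def algebra_simps)
  then have val: "Im (L / D) / pi = w x0 / (cmod D)\<^sup>2"
    by (simp add: ImL)
  have "w\<beta> x0 = Im (L / D) / pi"
    unfolding assms(12) using lim by (intro tendsto_Lim) auto
  then have w\<beta>: "w\<beta> x0 = w x0 / (cmod D)\<^sup>2"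
    using val by simp
  show ?thesis
  proof (intro conjI)
    show "((\<lambda>\<epsilon>. Im (stieltjes \<mu>\<beta> (Complex x0 \<epsilon>)) / pi) \<longlongrightarrow> w\<beta> x0) (at_right 0)"
      using lim val w\<beta> by simp
    show "w\<beta> x0 = w x0 / (1 + 2 * \<beta> * Re (stieltjes_bdry \<mu> x0) + \<beta>\<^sup>2 * (cmod (stieltjes_bdry \<mu> x0))\<^sup>2)"
      unfolding bdry w\<beta> normD ..
    show "w\<beta> x0 \<noteq> 0"
      using w D by (simp add: w\<beta>)
    show "sine_kernel_asymptotics p\<beta> x0 \<rho> (w\<beta> x0)"
      by (rule perturbed_kernel_scaling[OF rec' p0]) (simp add: w\<beta> D_def)
  qed
qed

end
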